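(* Consider the distributionally robust optimization problem $$\text{(DRO)}\qquad \min_{x\in X} f(x)\quad\text{s.t.}\quad \inf_{\mu\in\mathcal{M}}\mathbb{E}_\mu[h(x,\xi)]\ge 0$$ and the Moment-SOS algorithm described in the context. Assume $K^*=\mathscr{P}_d(S)+Y^*$ and that the primal-dual pair $(P_k)$–$(D_k)$ (defined in the context) has no duality gap, i.e. $f_k=\gamma_k$. Suppose the algorithm outputs $x^*=\pi(w^* )$ at a loop of relaxation order $k$, where $w^*$ is the computed optimizer of $(P_k)$. If $\mathrm{rank}\,M_t[w^*]=1$, then $x^*$ is a global optimizer of (DRO).
   Context: Variables: $x=(x_1,\dots,x_n)$ (decision) and $\xi=(\xi_1,\dots,\xi_p)$ (random). For $u\in\{x,\xi\}$ of dimension $l$, $\mathbb{N}^l_e=\{\alpha\in\mathbb{N}^l:|\alpha|\le e\}$, $[u]_e=(u^\alpha)_{\alpha\in\mathbb{N}^l_e}$ is the monomial vector, $\mathbb{R}[u]_e$ is the space of real polynomials in $u$ of degree at most $e$, and $\Sigma[u]_e$ is the set of sums of squares of polynomials that have degree at most $e$. For $q=\sum_\alpha q_\alpha u^\alpha\in\mathbb{R}[u]_e$ and $y\in\mathbb{R}^{\mathbb{N}^l_e}$, $\langle q,y\rangle=\sum_\alpha q_\alpha y_\alpha$. Data: $f\in\mathbb{R}[x]$, $h(x,\xi)\in\mathbb{R}[x,\xi]$, $X=\{x\in\mathbb{R}^n: c_1(x)\ge0,\dots,c_m(x)\ge 0\}$ with $c=(c_1,\dots,c_m)$, $c_i\in\mathbb{R}[x]$;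 $g=(g_1,\dots,g_{m_1})$ with $g_i\in\mathbb{R}[\xi]$, and $S=\{\xi\in\mathbb{R}^p: g_1(\xi)\ge0,\dots,g_{m_1}(\xi)\ge0\}$. Let $d$ be the degree of $h$ in $\xi$. The set $Y\subseteq\mathbb{R}^{\mathbb{N}^p_d}$ is given by linear, second-order cone and semidefinite constraints. The moment ambiguity set $\mathcal{M}$ is the set of (nonnegative) Borel measures $\mu$ on $\mathbb{R}^p$ with $\mathrm{supp}(\mu)\subseteq S$ and $\mathbb{E}_\mu([\xi]_d)\in Y$, where $\mathbb{E}_\mu$ denotes integration with respect to $\mu$. For a tuple of polynomials, $\deg$ is the maximum of the degrees. Let $t=\max\{\lceil \deg_x(h)/2\rceil,\lceil\deg(f)/2\rceil,\lceil\deg(c)/2\rceil\}$ ($\deg_x$ is the degree in $x$), $d_0=\max\{\lceil d/2\rceil,\lceil\deg(g)/2\rceil\}$, $d_2=\lceil\deg(g)/2\rceil$. Write $h(x,\xi)=\sum_{\beta\in\mathbb{N}^p_d}h_\beta(x)\xi^\beta$; $H$ is the unique real matrix with $(h_\beta(x))_{\beta\in\mathbb{N}^p_d}=H[x]_{2t}$. Cones: $cone(\cdot)$ is the conic hull. $K=cone(\{\mathbb{E}_\mu([\xi]_d):\mu\in\mathcal{M}\})$. For $T\subseteq\mathbb{R}^{\mathbb{N}^p_d}$, $T^*=\{q\in\mathbb{R}[\xi]_d:\langle q,y\rangle\ge0\ \forall y\in T\}$. $\mathscr{P}_d(S)=\{q\in\mathbb{R}[\xi]_d: q\ge 0\text{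 on }S\}$. The truncated quadratic module is $\mathrm{QM}[g]_{2k}=\Sigma[\xi]_{2k}+g_1\Sigma[\xi]_{2k-\deg(g_1)}+\cdots+g_{m_1}\Sigma[\xi]_{2k-\deg(g_{m_1})}$, and $\mathrm{QM}[c]_{2t}$ is defined in the same way in the variable $x$. For $w\in\mathbb{R}^{\mathbb{N}^l_{2k}}$ and $q\in\mathbb{R}[u]_{2k}$, the localizing matrix $L_q^{(k)}[w]$ is the symmetric matrix with $vec(b_1)^T L_q^{(k)}[w]\,vec(b_2)=\langle q b_1b_2,w\rangle$ for all $b_1,b_2\in\mathbb{R}[u]_s$, $s=k-\lceil\deg(q)/2\rceil$, where $vec(b)$ is the coefficient vector of $b$. The moment matrix is $M_k[w]=L_1^{(k)}[w]=(w_{\alpha+\beta})_{\alpha,\beta\in\mathbb{N}^l_k}$. For $w\in\mathbb{R}^{\mathbb{N}^n_{2t}}$, $w_0$ is the entry indexed by $0$ and $\pi(w)=(w_{e_1},\dots,w_{e_n})$. $z|_d=(z_\alpha)_{\alpha\in\mathbb{N}^p_d}$ is the degree-$d$ truncation. Relaxations of order $k\ge d_0$: $$(P_k)\quad f_k:=\min_w \langle f,w\rangle\ \text{ s.t. }\ (Hw)^T[\xi]_d\in(\mathrm{QM}[g]_{2k}\cap\mathbb{R}[\xi]_d)+Y^*,\ L^{(t)}_{c_i}[w]\succeq0\ (i=1,\dots,m),\ M_t[w]\succeq0,\ w_0=1,\ w\in\mathbb{R}^{\mathbb{N}^n_{2t}};$$ $$(D_k)\quad \gamma_k:=\max_{(\gamma,y,z)}\gamma\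 \text{ s.t. }\ f(x)-y^TH[x]_{2t}-\gamma\in\mathrm{QM}[c]_{2t},\ \gamma\in\mathbb{R},\ y\in cone(Y),\ y=z|_d,\ M_k[z]\succeq0,\ L^{(k)}_{g_i}[z]\succeq0\ (i=1,\dots,m_1),\ z\in\mathbb{R}^{\mathbb{N}^p_{2k}}.$$ Algorithm. Initialize $k:=d_0$, $k_1:=\lceil(d+1)/2\rceil$. Step 0: Formulate $cone(Y)$ and select a generic $R\in\Sigma[\xi]_{2k_1}$. Step 1: Solve $(P_k)$ and $(D_k)$ for optimizers $w^*$ and $(\gamma^*,y^*,z^* )$ respectively. Step 2: Solve the moment problem: minimize $\langle R,\hat z\rangle$ over $\hat z\in\mathbb{R}^{\mathbb{N}^p_{2k_1}}$ subject to $L^{(k_1)}_{g_i}[\hat z]\succeq0$ $(i=1,\dots,m_1)$, $M_{k_1}[\hat z]\succeq0$, $\hat z|_d=y^*$. If it is infeasible, set $k:=k+1$ and go back to Step 1; if it is feasible, solve it for an optimizer $\hat z^*$ and go to Step 3. Step 3: Check whether there is an integer $d_1\in[d_0,k_1]$ with $\mathrm{rank}\,M_{d_1}[\hat z^*]=\mathrm{rank}\,M_{d_1-d_2}[\hat z^*]$. If so, go to Step 4; otherwise set $k_1:=k_1+1$ and go back to Step 2. Step 4: Output $x^*=\pi(w^* )$ and terminate.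
   Formalization: The formal theorem additionally assumes deg(g) ≥ 1 (the tuple g is not made of constants only); if deg(g)=0 then d_2=0, the rank test of Step 3 is vacuous, and the claim fails. *)

theory Defs
  imports "HOL-Analysis.Analysis" "HOL-Analysis.Finite_Function_Topology"
begin

section \<open>Polynomials and truncated multi-sequences\<close>

text \<open>
  The variables are indexed by a finite type \<open>'v\<close>. A multi-index is a
  \<^typ>\<open>'v \<Rightarrow>\<^sub>0 nat\<close>, a polynomial is the finitely supported family of its coefficients, and
  multiplication is the convolution product of \<^theory>\<open>HOL-Library.Poly_Mapping\<close>.
  A polynomial in \<open>(x, \<xi>)\<close> is an element of \<open>\<real>[x][\<xi>]\<close>, so that \<open>lookup h \<beta>\<close> is \<open>h\<^sub>\<beta>(x)\<close>.

  A vector indexed by the multi-indices of degree at most \<open>e\<close> is a finitely supported family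
  that vanishes off those multi-indices. The space of these vectors is therefore literally the
  space of coefficient vectors of polynomials of degree at most \<open>e\<close>, and both are written
  \<open>trunc_space e\<close>; in particular \<open>vec(b)\<close> is \<open>b\<close> itself.
\<close>

type_synonym 'v mon = "'v \<Rightarrow>\<^sub>0 nat"
type_synonym 'v rpoly = "'v mon \<Rightarrow>\<^sub>0 real"
type_synonym 'v tms = "'v mon \<Rightarrow>\<^sub>0 real"
type_synonym ('n, 'p) bipoly = "'p mon \<Rightarrow>\<^sub>0 'n rpoly"

abbreviation lookup :: "('a \<Rightarrow>\<^sub>0 'b::zero) \<Rightarrow> 'a \<Rightarrow> 'b"
  where "lookup \<equiv> Poly_Mapping.lookup"

abbreviation keys :: "('a \<Rightarrow>\<^sub>0 'b::zero) \<Rightarrow> 'a set"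
  where "keys \<equiv> Poly_Mapping.keys"

abbreviation single :: "'a \<Rightarrow> 'b \<Rightarrow> ('a \<Rightarrow>\<^sub>0 'b::zero)"
  where "single \<equiv> Poly_Mapping.single"

definition mdeg :: "('v::finite) mon \<Rightarrow> nat"
  where "mdeg \<alpha> = (\<Sum>i\<in>UNIV. lookup \<alpha> i)"

definition mons :: "nat \<Rightarrow> ('v::finite) mon set"
  where "mons e = {\<alpha>. mdeg \<alpha> \<le> e}"

definition trunc_space :: "nat \<Rightarrow> (('v::finite) mon \<Rightarrow>\<^sub>0 real) set"
  where "trunc_space e = {p. keys p \<subseteq> mons e}"

definition tvec :: "nat \<Rightarrow> (('v::finite) mon \<Rightarrow> real) \<Rightarrow> 'v mon \<Rightarrow>\<^sub>0 real"
  where "tvec e F = (\<Sum>\<alpha>\<in>mons e. single \<alpha> (F \<alpha>))"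

text \<open>The zero polynomial, and the empty tuple below, get degree 0.\<close>

definition pdeg :: "(('v::finite) mon \<Rightarrow>\<^sub>0 'b::zero) \<Rightarrow> nat"
  where "pdeg p = Max (insert 0 (mdeg ` keys p))"

definition tuple_deg :: "('v::finite) rpoly list \<Rightarrow> nat"
  where "tuple_deg ps = Max (insert 0 (pdeg ` set ps))"

definition deg_x :: "('n::finite, 'p::finite) bipoly \<Rightarrow> nat"
  where "deg_x h = Max (insert 0 ((\<lambda>\<beta>. pdeg (lookup h \<beta>)) ` keys h))"

definition monom_val :: "real ^ ('v::finite) \<Rightarrow> 'v mon \<Rightarrow> real"
  where "monom_val u \<alpha> = (\<Prod>i\<in>UNIV. (u $ i) ^ lookup \<alpha> i)"

definition peval :: "('v::finite) rpoly \<Rightarrow> real ^ 'v \<Rightarrow> real"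
  where "peval p u = (\<Sum>\<alpha>\<in>keys p. lookup p \<alpha> * monom_val u \<alpha>)"

definition bieval :: "('n::finite, 'p::finite) bipoly \<Rightarrow> real ^ 'n \<Rightarrow> real ^ 'p \<Rightarrow> real"
  where "bieval h x \<xi> = (\<Sum>\<beta>\<in>keys h. peval (lookup h \<beta>) x * monom_val \<xi> \<beta>)"

definition pairing :: "('v::finite) rpoly \<Rightarrow> 'v tms \<Rightarrow> real"
  where "pairing q y = (\<Sum>\<alpha>\<in>keys q. lookup q \<alpha> * lookup y \<alpha>)"

definition trunc :: "nat \<Rightarrow> ('v::finite) tms \<Rightarrow> 'v tms"
  where "trunc e z = tvec e (lookup z)"

definition proj1 :: "('n::finite) tms \<Rightarrow> real ^ 'n"
  where "proj1 w = (\<chi> i. lookup w (single i 1))"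

text \<open>\<open>half_up d\<close> is \<open>\<lceil>d / 2\<rceil>\<close>.\<close>

definition half_up :: "nat \<Rightarrow> nat"
  where "half_up d = (d + 1) div 2"


section \<open>Sums of squares, quadratic modules, moment and localizing matrices\<close>

definition sos :: "nat \<Rightarrow> ('v::finite) rpoly set"
  where "sos e = {p \<in> trunc_space e. \<exists>qs. p = (\<Sum>q\<leftarrow>qs. q ^ 2)}"

text \<open>
  Used only for \<open>e \<ge> tuple_deg g\<close>, so that the subtraction on \<^typ>\<open>nat\<close> is never truncated.
\<close>

definition QM :: "('v::finite) rpoly list \<Rightarrow> nat \<Rightarrow> 'v rpoly set"
  where "QM g e = {\<sigma>0 + (\<Sum>i<length g. g ! i * \<sigma> i) | \<sigma>0 \<sigma>.
           \<sigma>0 \<in> sos e \<and> (\<forall>i<length g. \<sigma> i \<in> sos (e - pdeg (g ! i)))}"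

text \<open>Matrices are functions of two indices, considered on a finite index set \<open>I\<close>.\<close>

definition psd :: "'a set \<Rightarrow> ('a \<Rightarrow> 'a \<Rightarrow> real) \<Rightarrow> bool"
  where "psd I A \<longleftrightarrow> (\<forall>i\<in>I. \<forall>j\<in>I. A i j = A j i) \<and>
           (\<forall>v. (\<Sum>i\<in>I. \<Sum>j\<in>I. v i * A i j * v j) \<ge> 0)"

text \<open>Column rank: the dimension of the span of the columns.\<close>

definition mat_rank :: "'a set \<Rightarrow> ('a \<Rightarrow> 'a \<Rightarrow> real) \<Rightarrow> nat"
  where "mat_rank I A = dim ((\<lambda>j. \<Sum>i\<in>I. single i (A i j)) ` I)"

definition moment_mat :: "('v::finite) tms \<Rightarrow> 'v mon \<Rightarrow> 'v mon \<Rightarrow> real"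
  where "moment_mat w \<alpha> \<beta> = lookup w (\<alpha> + \<beta>)"

definition loc_mat :: "('v::finite) rpoly \<Rightarrow> 'v tms \<Rightarrow> 'v mon \<Rightarrow> 'v mon \<Rightarrow> real"
  where "loc_mat q w \<alpha> \<beta> = pairing (q * single \<alpha> 1 * single \<beta> 1) w"

text \<open>
  The rows and columns of the order \<open>k\<close> localizing matrix: the multi-indices of degree at most
  \<open>k - \<lceil>deg q / 2\<rceil>\<close>. The matrix is empty if that number is negative; this can happen only in
  the first passes of the algorithm through the moment problem.
\<close>

definition loc_index :: "nat \<Rightarrow> ('v::finite) rpoly \<Rightarrow> 'v mon set"
  where "loc_index k q = {\<alpha>. mdeg \<alpha> + half_up (pdeg q) \<le> k}"

definition moment_psd :: "nat \<Rightarrow> ('v::finite) tms \<Rightarrow> bool"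
  where "moment_psd k w \<longleftrightarrow> psd (mons k) (moment_mat w)"

definition loc_psd :: "nat \<Rightarrow> ('v::finite) rpoly \<Rightarrow> 'v tms \<Rightarrow> bool"
  where "loc_psd k q w \<longleftrightarrow> psd (loc_index k q) (loc_mat q w)"

definition moment_rank :: "nat \<Rightarrow> ('v::finite) tms \<Rightarrow> nat"
  where "moment_rank k w = mat_rank (mons k) (moment_mat w)"

lemma half_up_ceiling: "int (half_up d) = \<lceil>real d / 2\<rceil>"
  unfolding half_up_def by linarith

lemma finite_mons: "finite (mons e :: ('v::finite) mon set)"
proof -
  have inj: "inj_on (lookup :: 'v mon \<Rightarrow> _) (mons e)"
    by (intro inj_onI poly_mapping_eqI) simp
  have "lookup \<alpha> i \<le> e" if "\<alpha> \<in> mons e" for \<alpha> :: "'v mon" and i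
    using member_le_sum[of i UNIV "lookup \<alpha>"] that by (simp add: mons_def mdeg_def)
  hence "lookup ` (mons e :: 'v mon set) \<subseteq> Pi\<^sub>E UNIV (\<lambda>_. {..e})"
    by auto
  moreover have "finite (Pi\<^sub>E (UNIV :: 'v set) (\<lambda>_. {..e}))"
    by (simp add: finite_PiE)
  ultimately show ?thesis
    using inj finite_imageD finite_subset by blast
qed

lemma lookup_tvec: "lookup (tvec e F) \<alpha> = (if \<alpha> \<in> mons e then F \<alpha> else 0)"
  by (simp add: tvec_def lookup_sum lookup_single when_def finite_mons)

lemma pairing_superset:
  assumes "finite A" "keys q \<subseteq> A"
  shows "pairing q y = (\<Sum>\<alpha>\<in>A. lookup q \<alpha> * lookup y \<alpha>)"
  unfolding pairing_def by (rule sum.mono_neutral_left) (use assms in \<open>auto simp: in_keys_iff\<close>)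

lemma pairing_add: "pairing (p + q) y = pairing p y + pairing q y"
proof -
  let ?A = "keys p \<union> keys q"
  have "keys (p + q) \<subseteq> ?A" by (rule Poly_Mapping.keys_add)
  thus ?thesis
    by (simp add: pairing_superset[of ?A] lookup_add algebra_simps sum.distrib)
qed

lemma pairing_sum: "pairing (\<Sum>i\<in>A. p i) y = (\<Sum>i\<in>A. pairing (p i) y)"
  by (induction A rule: infinite_finite_induct) (simp_all add: pairing_add, simp_all add: pairing_def)

lemma pairing_const_mult: "pairing (p * single 0 a) y = a * pairing p y"
proof -
  have l: "lookup (p * single 0 a) \<alpha> = a * lookup p \<alpha>" for \<alpha>
  proof -
    have "lookup (single 0 a * p) \<alpha> = a * lookup p \<alpha>"
      unfolding mult_map_scale_conv_mult[symmetric] by (simp add: map.rep_eq when_def)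
    thus ?thesis by (simp add: mult.commute)
  qed
  hence "keys (p * single 0 a) \<subseteq> keys p" by (auto simp: in_keys_iff)
  thus ?thesis
    by (simp add: pairing_superset[of "keys p"] l sum_distrib_left mult.assoc)
qed

text \<open>The property that defines the localizing matrix, and the case \<open>q = 1\<close>.\<close>

lemma loc_mat_bilinear:
  "(\<Sum>\<alpha>\<in>keys b1. \<Sum>\<beta>\<in>keys b2. lookup b1 \<alpha> * loc_mat q w \<alpha> \<beta> * lookup b2 \<beta>)
     = pairing (q * b1 * b2) w"
proof -
  have decomp: "b = (\<Sum>\<alpha>\<in>keys b. single \<alpha> 1 * single 0 (lookup b \<alpha>))" for b :: "'a rpoly"
    by (rule poly_mapping_eqI) (simp add: mult_single lookup_sum lookup_single when_def in_keys_iff)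
  let ?s = "\<lambda>b \<alpha>. single \<alpha> 1 * single 0 (lookup b \<alpha>)"
  have "q * b1 * b2 = q * (\<Sum>\<alpha>\<in>keys b1. ?s b1 \<alpha>) * (\<Sum>\<beta>\<in>keys b2. ?s b2 \<beta>)"
    using decomp[of b1] decomp[of b2] by metis
  also have "\<dots> = (\<Sum>\<alpha>\<in>keys b1. \<Sum>\<beta>\<in>keys b2. q * ?s b1 \<alpha> * ?s b2 \<beta>)"
    by (simp only: sum_distrib_left sum_distrib_right)
       (rule sum.swap)
  also have "\<dots> = (\<Sum>\<alpha>\<in>keys b1. \<Sum>\<beta>\<in>keys b2.
      q * single \<alpha> 1 * single \<beta> 1 * single 0 (lookup b1 \<alpha>) * single 0 (lookup b2 \<beta>))"
    by (simp only: mult_ac)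
  finally have eq: "q * b1 * b2 = \<dots>" .
  show ?thesis
    unfolding eq pairing_sum pairing_const_mult loc_mat_def by (simp only: ac_simps)
qed

lemma loc_mat_one: "loc_mat 1 w = moment_mat w"
  by (intro ext) (simp add: loc_mat_def moment_mat_def mult_single pairing_def)


section \<open>The problem data\<close>

definition basic_set :: "('v::finite) rpoly list \<Rightarrow> (real ^ 'v) set"
  where "basic_set ps = {u. \<forall>p\<in>set ps. peval p u \<ge> 0}"

text \<open>
  A constraint on \<open>y\<close> is built from affine functionals \<open>y \<mapsto> a\<^sub>0 + \<langle>a, y\<rangle>\<close>, written \<open>(a\<^sub>0, a)\<close>:
  an affine equation or inequality, a second-order cone constraint
  \<open>\<parallel>(l\<^sub>1(y), \<dots>, l\<^sub>r(y))\<parallel> \<le> l\<^sub>0(y)\<close>, or a linear matrix inequality of size \<open>N\<close>.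
\<close>

type_synonym 'p affine_fun = "real \<times> 'p rpoly"

definition aff :: "('p::finite) affine_fun \<Rightarrow> 'p tms \<Rightarrow> real"
  where "aff l y = fst l + pairing (snd l) y"

datatype 'p conic_constraint =
    Lin_Eq "'p affine_fun"
  | Lin_Ineq "'p affine_fun"
  | SOC "'p affine_fun" "'p affine_fun list"
  | SDP nat "nat \<Rightarrow> nat \<Rightarrow> 'p affine_fun"

fun satisfies :: "('p::finite) tms \<Rightarrow> 'p conic_constraint \<Rightarrow> bool"
  where
    "satisfies y (Lin_Eq l) \<longleftrightarrow> aff l y = 0"
  | "satisfies y (Lin_Ineq l) \<longleftrightarrow> aff l y \<ge> 0"
  | "satisfies y (SOC l0 ls) \<longleftrightarrow> sqrt (\<Sum>l\<leftarrow>ls. (aff l y)\<^sup>2) \<le> aff l0 y"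
  | "satisfies y (SDP N A) \<longleftrightarrow> psd {..<N} (\<lambda>i j. aff (A i j) y)"

definition conic_set :: "nat \<Rightarrow> ('p::finite) tms set \<Rightarrow> bool"
  where "conic_set d Y \<longleftrightarrow> (\<exists>Cs. Y = {y \<in> trunc_space d. \<forall>C\<in>set Cs. satisfies y C})"

definition msupport :: "(real ^ ('p::finite)) measure \<Rightarrow> (real ^ 'p) set"
  where "msupport \<mu> = {\<xi>. \<forall>U. open U \<and> \<xi> \<in> U \<longrightarrow> emeasure \<mu> U > 0}"

definition mom_vec :: "nat \<Rightarrow> (real ^ ('p::finite)) measure \<Rightarrow> 'p tms"
  where "mom_vec d \<mu> = tvec d (\<lambda>\<beta>. \<integral>\<xi>. monom_val \<xi> \<beta> \<partial>\<mu>)"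

text \<open>
  Membership of the moment vector in \<open>Y\<close> includes that the moments exist; without the
  integrability condition a divergent moment would silently count as 0.
\<close>

definition ambiguity_set ::
    "nat \<Rightarrow> ('p::finite) rpoly list \<Rightarrow> 'p tms set \<Rightarrow> (real ^ 'p) measure set"
  where "ambiguity_set d g Y = {\<mu>. sets \<mu> = sets borel \<and> msupport \<mu> \<subseteq> basic_set g \<and>
           (\<forall>\<beta>\<in>mons d. integrable \<mu> (\<lambda>\<xi>. monom_val \<xi> \<beta>)) \<and> mom_vec d \<mu> \<in> Y}"

text \<open>The infimum is taken in the extended reals, so it is \<open>\<infinity>\<close> for an empty ambiguity set.\<close>

definition DRO_feasible ::
    "('n::finite, 'p::finite) bipoly \<Rightarrow> 'n rpoly list \<Rightarrow> 'p rpoly list \<Rightarrow> 'p tms set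
      \<Rightarrow> real ^ 'n \<Rightarrow> bool"
  where "DRO_feasible h c g Y x \<longleftrightarrow> x \<in> basic_set c \<and>
           (INF \<mu>\<in>ambiguity_set (pdeg h) g Y. ereal (\<integral>\<xi>. bieval h x \<xi> \<partial>\<mu>)) \<ge> 0"

definition DRO_optimizer ::
    "'n rpoly \<Rightarrow> ('n::finite, 'p::finite) bipoly \<Rightarrow> 'n rpoly list \<Rightarrow> 'p rpoly list \<Rightarrow> 'p tms set
      \<Rightarrow> real ^ 'n \<Rightarrow> bool"
  where "DRO_optimizer f h c g Y x \<longleftrightarrow> is_arg_min (peval f) (DRO_feasible h c g Y) x"

definition order_t :: "'n rpoly \<Rightarrow> ('n::finite, 'p::finite) bipoly \<Rightarrow> 'n rpoly list \<Rightarrow> nat"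
  where "order_t f h c = Max {half_up (deg_x h), half_up (pdeg f), half_up (tuple_deg c)}"

definition order_d0 :: "('n::finite, 'p::finite) bipoly \<Rightarrow> 'p rpoly list \<Rightarrow> nat"
  where "order_d0 h g = max (half_up (pdeg h)) (half_up (tuple_deg g))"

text \<open>
  The rank test below compares the moment matrices of orders \<open>d1\<close> and \<open>d1 - order_d2 g\<close>. It is
  vacuous if \<open>g\<close> consists of constants, whence the standing assumption \<open>tuple_deg g \<ge> 1\<close>.
\<close>

definition order_d2 :: "('p::finite) rpoly list \<Rightarrow> nat"
  where "order_d2 g = half_up (tuple_deg g)"


section \<open>Cones\<close>

definition dual_cone :: "nat \<Rightarrow> ('p::finite) tms set \<Rightarrow> 'p rpoly set"
  where "dual_cone d T = {q \<in> trunc_space d. \<forall>y\<in>T. pairing q y \<ge> 0}"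

definition nonneg_polys :: "nat \<Rightarrow> (real ^ ('p::finite)) set \<Rightarrow> 'p rpoly set"
  where "nonneg_polys d S = {q \<in> trunc_space d. \<forall>\<xi>\<in>S. peval q \<xi> \<ge> 0}"

definition moment_cone :: "nat \<Rightarrow> ('p::finite) rpoly list \<Rightarrow> 'p tms set \<Rightarrow> 'p tms set"
  where "moment_cone d g Y = convex_cone hull (mom_vec d ` ambiguity_set d g Y)"


section \<open>The primal-dual pair of relaxations\<close>

definition H_mat :: "('n::finite, 'p::finite) bipoly \<Rightarrow> 'p mon \<Rightarrow> 'n mon \<Rightarrow> real"
  where "H_mat h \<beta> \<alpha> = lookup (lookup h \<beta>) \<alpha>"

text \<open>
  \<open>H_app t h w\<close> is the vector \<open>Hw\<close>, i.e. the polynomial \<open>(Hw)\<^sup>T[\<xi>]\<^sub>d\<close>;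
  \<open>H_app_transpose t h y\<close> is the row \<open>y\<^sup>TH\<close>, i.e. the polynomial \<open>y\<^sup>TH[x]\<^sub>2\<^sub>t\<close>.
\<close>

definition H_app :: "nat \<Rightarrow> ('n::finite, 'p::finite) bipoly \<Rightarrow> 'n tms \<Rightarrow> 'p rpoly"
  where "H_app t h w = tvec (pdeg h) (\<lambda>\<beta>. \<Sum>\<alpha>\<in>mons (2 * t). H_mat h \<beta> \<alpha> * lookup w \<alpha>)"

definition H_app_transpose :: "nat \<Rightarrow> ('n::finite, 'p::finite) bipoly \<Rightarrow> 'p tms \<Rightarrow> 'n rpoly"
  where "H_app_transpose t h y =
           tvec (2 * t) (\<lambda>\<alpha>. \<Sum>\<beta>\<in>mons (pdeg h). lookup y \<beta> * H_mat h \<beta> \<alpha>)"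

definition P_feasible ::
    "'n rpoly \<Rightarrow> ('n::finite, 'p::finite) bipoly \<Rightarrow> 'n rpoly list \<Rightarrow> 'p rpoly list \<Rightarrow> 'p tms set
      \<Rightarrow> nat \<Rightarrow> 'n tms \<Rightarrow> bool"
  where "P_feasible f h c g Y k w \<longleftrightarrow>
     (let t = order_t f h c; d = pdeg h in
        w \<in> trunc_space (2 * t) \<and>
        H_app t h w \<in> (QM g (2 * k) \<inter> trunc_space d) + dual_cone d Y \<and>
        (\<forall>p\<in>set c. loc_psd t p w) \<and> moment_psd t w \<and> lookup w 0 = 1)"

definition D_feasible ::
    "'n rpoly \<Rightarrow> ('n::finite, 'p::finite) bipoly \<Rightarrow> 'n rpoly list \<Rightarrow> 'p rpoly list \<Rightarrow> 'p tms set
      \<Rightarrow> nat \<Rightarrow> real \<times> 'p tms \<times> 'p tms \<Rightarrow> bool"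
  where "D_feasible f h c g Y k = (\<lambda>(\<gamma>, y, z).
     let t = order_t f h c; d = pdeg h in
        f - H_app_transpose t h y - single 0 \<gamma> \<in> QM c (2 * t) \<and>
        y \<in> convex_cone hull Y \<and> z \<in> trunc_space (2 * k) \<and> y = trunc d z \<and>
        moment_psd k z \<and> (\<forall>p\<in>set g. loc_psd k p z))"

definition P_value ::
    "'n rpoly \<Rightarrow> ('n::finite, 'p::finite) bipoly \<Rightarrow> 'n rpoly list \<Rightarrow> 'p rpoly list \<Rightarrow> 'p tms set
      \<Rightarrow> nat \<Rightarrow> ereal"
  where "P_value f h c g Y k = (INF w\<in>Collect (P_feasible f h c g Y k). ereal (pairing f w))"

definition D_value ::
    "'n rpoly \<Rightarrow> ('n::finite, 'p::finite) bipoly \<Rightarrow> 'n rpoly list \<Rightarrow> 'p rpoly list \<Rightarrow> 'p tms set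
      \<Rightarrow> nat \<Rightarrow> ereal"
  where "D_value f h c g Y k =
           (SUP (\<gamma>, y, z)\<in>Collect (D_feasible f h c g Y k). ereal \<gamma>)"

lemma bieval_H_mat:
  assumes "deg_x h \<le> 2 * t" and "\<beta> \<in> mons (pdeg h)"
  shows "peval (lookup h \<beta>) x = (\<Sum>\<alpha>\<in>mons (2 * t). H_mat h \<beta> \<alpha> * monom_val x \<alpha>)"
proof -
  have "keys (lookup h \<beta>) \<subseteq> mons (2 * t)"
  proof (cases "\<beta> \<in> keys h")
    case True
    have "mdeg \<alpha> \<le> 2 * t" if "\<alpha> \<in> keys (lookup h \<beta>)" for \<alpha>
    proof -
      have "mdeg \<alpha> \<le> pdeg (lookup h \<beta>)" using that by (simp add: pdeg_def)
      also have "\<dots> \<le> deg_x h" using True by (simp add: deg_x_def)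
      finally show ?thesis using assms by simp
    qed
    thus ?thesis by (auto simp: mons_def)
  qed (simp add: in_keys_iff)
  thus ?thesis
    unfolding peval_def H_mat_def
    by (intro sum.mono_neutral_left) (auto simp: finite_mons in_keys_iff)
qed


section \<open>The algorithm\<close>

definition MP_feasible ::
    "nat \<Rightarrow> ('p::finite) rpoly list \<Rightarrow> nat \<Rightarrow> 'p tms \<Rightarrow> 'p tms \<Rightarrow> bool"
  where "MP_feasible d g k1 y z \<longleftrightarrow> z \<in> trunc_space (2 * k1) \<and>
           (\<forall>p\<in>set g. loc_psd k1 p z) \<and> moment_psd k1 z \<and> trunc d z = y"

definition rank_condition ::
    "('n::finite, 'p::finite) bipoly \<Rightarrow> 'p rpoly list \<Rightarrow> nat \<Rightarrow> 'p tms \<Rightarrow> bool"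
  where "rank_condition h g k1 z \<longleftrightarrow>
           (\<exists>d1\<in>{order_d0 h g..k1}. moment_rank d1 z = moment_rank (d1 - order_d2 g) z)"

text \<open>
  The control states are the entries to Steps 1, 2, 3 and the termination in Step 4, together
  with the current values of \<open>k\<close>, \<open>k\<^sub>1\<close> and of the computed optimizers.
\<close>

datatype ('n, 'p) alg_state =
    Step1 nat nat
  | Step2 nat nat "'n tms" "'p tms"
  | Step3 nat nat "'n tms" "'p tms" "'p tms"
  | Output nat "'n tms" "real ^ 'n"

text \<open>
  Any optimizers may be computed; the algorithm is stuck at a solvable problem without optimizer.
\<close>

inductive alg_step ::
    "'n rpoly \<Rightarrow> ('n::finite, 'p::finite) bipoly \<Rightarrow> 'n rpoly list \<Rightarrow> 'p rpoly list \<Rightarrow> 'p tms set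
      \<Rightarrow> 'p rpoly \<Rightarrow> ('n, 'p) alg_state \<Rightarrow> ('n, 'p) alg_state \<Rightarrow> bool"
  for f h c g Y R
  where
    solve_pair:
      "is_arg_min (pairing f) (P_feasible f h c g Y k) w \<Longrightarrow>
       is_arg_max fst (D_feasible f h c g Y k) (\<gamma>, y, z) \<Longrightarrow>
       alg_step f h c g Y R (Step1 k k1) (Step2 k k1 w y)"
  | moment_infeasible:
      "\<not> (\<exists>zh. MP_feasible (pdeg h) g k1 y zh) \<Longrightarrow>
       alg_step f h c g Y R (Step2 k k1 w y) (Step1 (k + 1) k1)"
  | moment_feasible:
      "is_arg_min (pairing R) (MP_feasible (pdeg h) g k1 y) zh \<Longrightarrow>
       alg_step f h c g Y R (Step2 k k1 w y) (Step3 k k1 w y zh)"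
  | rank_fails:
      "\<not> rank_condition h g k1 zh \<Longrightarrow>
       alg_step f h c g Y R (Step3 k k1 w y zh) (Step2 k (k1 + 1) w y)"
  | rank_holds:
      "rank_condition h g k1 zh \<Longrightarrow>
       alg_step f h c g Y R (Step3 k k1 w y zh) (Output k w (proj1 w))"

definition init_k1 :: "('n::finite, 'p::finite) bipoly \<Rightarrow> nat"
  where "init_k1 h = half_up (pdeg h + 1)"

definition alg_outputs ::
    "'n rpoly \<Rightarrow> ('n::finite, 'p::finite) bipoly \<Rightarrow> 'n rpoly list \<Rightarrow> 'p rpoly list \<Rightarrow> 'p tms set
      \<Rightarrow> 'p rpoly \<Rightarrow> nat \<Rightarrow> 'n tms \<Rightarrow> real ^ 'n \<Rightarrow> bool"
  where "alg_outputs f h c g Y R k w x \<longleftrightarrow>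
           (alg_step f h c g Y R)\<^sup>*\<^sup>* (Step1 (order_d0 h g) (init_k1 h)) (Output k w x)"

end

theory Submission
  imports Defs
begin

text \<open>
  Why the theorem holds. The rank one condition together with \<open>w\<^sub>0 = 1\<close> forces \<open>w = [x\<^sup>*]\<^sub>2\<^sub>t\<close>
  (lemma \<open>rank_one_moments\<close>). Hence \<open>\<langle>f, w\<rangle> = f(x\<^sup>*)\<close>, the \<open>(0,0)\<close> entries of the localizing matrices
  say \<open>x\<^sup>* \<in> X\<close>, and \<open>Hw\<close> is the coefficient vector of \<open>h(x\<^sup>*, \<cdot>)\<close>. The latter lies in
  \<open>QM[g] + Y\<^sup>* \<subseteq> P\<^sub>d(S) + Y\<^sup>* = K\<^sup>*\<close>, and membership of \<open>h(x, \<cdot>)\<close> in \<open>K\<^sup>*\<close> is exactly what the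
  robust constraint at \<open>x\<close> says (lemma \<open>DRO_feasible_iff\<close>). So \<open>x\<^sup>*\<close> is feasible.

  For optimality let \<open>(\<gamma>, y, z)\<close> be the dual optimizer. Without duality gap \<open>\<gamma> = f(x\<^sup>*)\<close>, and the dual
  constraint gives \<open>f(x) - \<langle>h(x, \<cdot>), y\<rangle> - \<gamma> \<ge> 0\<close> on \<open>X\<close>. It remains to see that
  \<open>\<langle>h(x, \<cdot>), y\<rangle> \<ge> 0\<close> for every feasible \<open>x\<close>. By the assumption on \<open>K\<^sup>*\<close> write \<open>h(x, \<cdot>) = p + q\<close>
  with \<open>p \<ge> 0\<close> on \<open>S\<close> and \<open>q \<in> Y\<^sup>*\<close>. Then \<open>\<langle>q, y\<rangle> \<ge> 0\<close> because \<open>y \<in> cone(Y)\<close>, and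
  \<open>\<langle>p, y\<rangle> \<ge> 0\<close> because \<open>y\<close> is the truncation of a sequence that passes the rank test, so that it
  consists of the moments of an atomic measure on \<open>S\<close>.

  The last claim is the flat extension theorem of Curto and Fialkow (theorem \<open>flat_extension\<close> and
  lemma \<open>flat_extension_nonneg\<close>), and it is the substantial part of the development. The form
  \<open>B(p, q) = \<langle>pq, z\<rangle>\<close> is positive semidefinite on polynomials of degree at most \<open>k\<close>. Flatness says
  that modulo its kernel every such polynomial is represented by one of degree less than \<open>k\<close>, so
  the multiplications by the variables act on the quotient, as commuting symmetric operators of a
  finite-dimensional Euclidean space. Their joint eigenvectors form an orthonormal basis (lemma
  \<open>commuting_symmetric_operators_have_joint_eigenbasis\<close>), the tuples of eigenvalues are the atoms,
  and polynomials representing the eigenvectors interpolate at the atoms, which turns positivity of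
  the localizing matrix of \<open>q\<close> into \<open>q \<ge> 0\<close> at each atom.
\<close>


section \<open>Linearity, evaluation and degree of polynomials\<close>

lemma poly_mapping_decomp:
  fixes p :: "'a \<Rightarrow>\<^sub>0 'b::comm_monoid_add"
  shows "p = (\<Sum>\<alpha>\<in>keys p. single \<alpha> (lookup p \<alpha>))"
  by (rule poly_mapping_eqI) (simp add: lookup_sum lookup_single when_def in_keys_iff)

lemma lookup_scaleR: "lookup (c *\<^sub>R p) \<alpha> = c * lookup p \<alpha>" for p :: "'a \<Rightarrow>\<^sub>0 real"
proof -
  have "finite {\<alpha>. c *\<^sub>R lookup p \<alpha> \<noteq> 0}"
    by (rule finite_subset[OF _ finite_keys[of p]]) (auto simp: in_keys_iff)
  thus ?thesis by (simp add: scaleR_poly_mapping_def)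
qed

lemma scaleR_conv_mult: "c *\<^sub>R p = single 0 c * p" for p :: "('v::finite) rpoly"
  unfolding mult_map_scale_conv_mult[symmetric]
  by (rule poly_mapping_eqI) (simp add: lookup_scaleR map.rep_eq when_def)

lemma peval_superset:
  assumes "finite A" "keys q \<subseteq> A"
  shows "peval q u = (\<Sum>\<alpha>\<in>A. lookup q \<alpha> * monom_val u \<alpha>)"
  unfolding peval_def by (rule sum.mono_neutral_left) (use assms in \<open>auto simp: in_keys_iff\<close>)

lemma peval_add: "peval (p + q) u = peval p u + peval q u"
proof -
  let ?A = "keys p \<union> keys q"
  have "keys (p + q) \<subseteq> ?A" by (rule Poly_Mapping.keys_add)
  thus ?thesis
    by (simp add: peval_superset[of ?A] lookup_add algebra_simps sum.distrib)
qed

lemma peval_0 [simp]: "peval 0 u = 0"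
  by (simp add: peval_def)

lemma peval_sum: "peval (\<Sum>i\<in>A. p i) u = (\<Sum>i\<in>A. peval (p i) u)"
  by (induction A rule: infinite_finite_induct) (simp_all add: peval_add)

lemma peval_sum_list: "peval (\<Sum>q\<leftarrow>qs. p q) u = (\<Sum>q\<leftarrow>qs. peval (p q) u)"
  by (induction qs) (simp_all add: peval_add)

lemma peval_single: "peval (single \<alpha> a) u = a * monom_val u \<alpha>"
  by (simp add: peval_def)

lemma monom_val_0 [simp]: "monom_val u 0 = 1"
  by (simp add: monom_val_def)

lemma monom_val_add: "monom_val u (\<alpha> + \<beta>) = monom_val u \<alpha> * monom_val u \<beta>"
  by (simp add: monom_val_def lookup_add power_add prod.distrib)

lemma monom_val_single: "monom_val u (single i 1) = u $ i"
proof -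
  have "monom_val u (single i 1) = (\<Prod>j\<in>UNIV. if j = i then u $ i else 1)"
    unfolding monom_val_def by (intro prod.cong) (auto simp: lookup_single)
  thus ?thesis by simp
qed

lemma peval_mult: "peval (p * q) u = peval p u * peval q u"
proof -
  have "p * q = (\<Sum>\<alpha>\<in>keys p. \<Sum>\<beta>\<in>keys q. single (\<alpha> + \<beta>) (lookup p \<alpha> * lookup q \<beta>))"
    by (subst (1) poly_mapping_decomp[of p], subst (1) poly_mapping_decomp[of q])
       (simp add: sum_distrib_left sum_distrib_right mult_single, rule sum.swap)
  thus ?thesis
    by (simp add: peval_sum peval_single monom_val_add peval_def[of p] peval_def[of q]
        sum_product mult_ac)
qed

lemma peval_diff: "peval (p - q) u = peval p u - peval q u"
  using peval_add[of "p - q" q u] by simp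

lemma pairing_0 [simp]: "pairing 0 y = 0"
  by (simp add: pairing_def)

lemma pairing_single: "pairing (single \<alpha> a) y = a * lookup y \<alpha>"
  by (simp add: pairing_def)

lemma pairing_scaleR: "pairing (c *\<^sub>R p) y = c * pairing p y"
  by (simp add: scaleR_conv_mult mult.commute[of _ p] pairing_const_mult)

lemma pairing_add_right: "pairing q (y + z) = pairing q y + pairing q z"
  by (simp add: pairing_def lookup_add algebra_simps sum.distrib)

lemma pairing_scaleR_right: "pairing q (c *\<^sub>R y) = c * pairing q y"
  by (simp add: pairing_def lookup_scaleR sum_distrib_left mult_ac)

lemma pairing_tvec: "pairing (tvec e F) y = (\<Sum>\<alpha>\<in>mons e. F \<alpha> * lookup y \<alpha>)"
proof -
  have "keys (tvec e F) \<subseteq> mons e" by (auto simp: in_keys_iff lookup_tvec split: if_splits)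
  thus ?thesis by (simp add: pairing_superset[OF finite_mons] lookup_tvec)
qed

lemma peval_tvec: "peval (tvec e F) u = (\<Sum>\<alpha>\<in>mons e. F \<alpha> * monom_val u \<alpha>)"
proof -
  have "keys (tvec e F) \<subseteq> mons e" by (auto simp: in_keys_iff lookup_tvec split: if_splits)
  thus ?thesis by (simp add: peval_superset[OF finite_mons] lookup_tvec)
qed

lemma pairing_trunc: "q \<in> trunc_space e \<Longrightarrow> pairing q (trunc e z) = pairing q z"
  unfolding pairing_def trunc_def trunc_space_def
  by (intro sum.cong) (auto simp: lookup_tvec)

lemma mdeg_0 [simp]: "mdeg 0 = 0"
  by (simp add: mdeg_def)

lemma mdeg_add: "mdeg (\<alpha> + \<beta>) = mdeg \<alpha> + mdeg \<beta>"
  by (simp add: mdeg_def lookup_add sum.distrib)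

lemma mdeg_single: "mdeg (single i a) = a"
  by (simp add: mdeg_def lookup_single when_def)

lemma mdeg_eq_0_iff: "mdeg \<alpha> = 0 \<longleftrightarrow> \<alpha> = 0"
  by (auto simp: mdeg_def intro: poly_mapping_eqI)

text \<open>
  Peeling off one variable is the induction step for statements on monomials of bounded degree.
\<close>

lemma mdeg_Suc_decomp:
  assumes "mdeg \<alpha> = Suc n"
  obtains i \<beta> where "\<alpha> = single i 1 + \<beta>" "mdeg \<beta> = n"
proof -
  have "\<exists>i. lookup \<alpha> i \<noteq> 0"
    using assms mdeg_eq_0_iff[of \<alpha>] by (metis lookup_zero nat.distinct(1) poly_mapping_eqI)
  then obtain i where i: "lookup \<alpha> i \<noteq> 0" by blast
  define \<beta> where "\<beta> = \<alpha> - single i 1"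
  have "\<alpha> = single i 1 + \<beta>"
    by (rule poly_mapping_eqI) (use i in \<open>auto simp: \<beta>_def lookup_add lookup_minus lookup_single when_def\<close>)
  moreover from this have "mdeg \<beta> = n" using assms mdeg_add[of "single i 1" \<beta>] by (simp add: mdeg_single)
  ultimately show thesis by (rule that)
qed

lemma mdeg_split:
  assumes "mdeg \<alpha> \<le> a + b"
  obtains \<beta> \<gamma> where "\<alpha> = \<beta> + \<gamma>" "mdeg \<beta> \<le> a" "mdeg \<gamma> \<le> b"
proof -
  have "\<exists>\<beta> \<gamma>. \<alpha> = \<beta> + \<gamma> \<and> mdeg \<beta> \<le> a \<and> mdeg \<gamma> \<le> b"
    using assms
  proof (induction a arbitrary: \<alpha>)
    case 0
    thus ?case by (intro exI[of _ 0] exI[of _ \<alpha>]) simp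
  next
    case (Suc a)
    show ?case
    proof (cases "mdeg \<alpha>")
      case 0
      thus ?thesis by (intro exI[of _ 0] exI[of _ \<alpha>]) simp
    next
      case (Suc n)
      then obtain i \<alpha>' where \<alpha>: "\<alpha> = single i 1 + \<alpha>'" "mdeg \<alpha>' = n" by (rule mdeg_Suc_decomp)
      have "mdeg \<alpha>' \<le> a + b" using \<open>mdeg \<alpha> \<le> Suc a + b\<close> Suc \<alpha>(2) by simp
      then obtain \<beta> \<gamma> where "\<alpha>' = \<beta> + \<gamma>" "mdeg \<beta> \<le> a" "mdeg \<gamma> \<le> b" using Suc.IH by blast
      thus ?thesis
        by (intro exI[of _ "single i 1 + \<beta>"] exI[of _ \<gamma>]) (simp add: \<alpha> mdeg_add mdeg_single add.assoc)
    qed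
  qed
  thus thesis using that by blast
qed

lemma mem_trunc_space_iff: "p \<in> trunc_space e \<longleftrightarrow> (\<forall>\<alpha>\<in>keys p. mdeg \<alpha> \<le> e)"
  by (auto simp: trunc_space_def mons_def)

lemma trunc_space_mult:
  assumes "p \<in> trunc_space a" "q \<in> trunc_space b"
  shows "p * q \<in> trunc_space (a + b)"
proof -
  have "mdeg \<gamma> \<le> a + b" if \<gamma>: "\<gamma> \<in> keys (p * q)" for \<gamma>
  proof -
    obtain \<alpha> \<beta> where "\<gamma> = \<alpha> + \<beta>" "\<alpha> \<in> keys p" "\<beta> \<in> keys q"
      using keys_mult[of p q] \<gamma> by blast
    thus ?thesis using assms by (auto simp: mem_trunc_space_iff mdeg_add add_mono)
  qed
  thus ?thesis by (simp add: mem_trunc_space_iff)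
qed

lemma trunc_space_mono: "a \<le> b \<Longrightarrow> trunc_space a \<subseteq> trunc_space b"
  by (force simp: mem_trunc_space_iff)

lemma trunc_space_pdeg: "p \<in> trunc_space (pdeg p)"
  by (simp add: mem_trunc_space_iff pdeg_def)

lemma single_in_trunc_space: "mdeg \<alpha> \<le> e \<Longrightarrow> single \<alpha> a \<in> trunc_space e"
  by (simp add: mem_trunc_space_iff)

lemma subspace_trunc_space: "subspace (trunc_space e)"
  unfolding subspace_def
proof (intro conjI ballI allI)
  fix p q :: "'a rpoly" and c :: real
  assume p: "p \<in> trunc_space e"
  show "c *\<^sub>R p \<in> trunc_space e"
    using p by (auto simp: mem_trunc_space_iff in_keys_iff lookup_scaleR)
  assume q: "q \<in> trunc_space e"
  show "p + q \<in> trunc_space e"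
    using p q Poly_Mapping.keys_add[of p q] by (auto simp: mem_trunc_space_iff)
qed (simp add: mem_trunc_space_iff)

lemma trunc_space_eq_span: "trunc_space e = span ((\<lambda>\<alpha>. single \<alpha> 1) ` mons e)"
proof (intro antisym span_minimal subspace_trunc_space subsetI)
  fix p :: "'a rpoly" assume p: "p \<in> trunc_space e"
  have "single \<alpha> (lookup p \<alpha>) = lookup p \<alpha> *\<^sub>R single \<alpha> 1" for \<alpha>
    by (rule poly_mapping_eqI) (simp add: lookup_scaleR lookup_single when_def)
  hence "p = (\<Sum>\<alpha>\<in>keys p. lookup p \<alpha> *\<^sub>R single \<alpha> 1)"
    using poly_mapping_decomp[of p] by simp
  moreover have "\<dots> \<in> span ((\<lambda>\<alpha>. single \<alpha> 1) ` mons e)"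
    using p by (intro span_sum span_scale span_base) (auto simp: trunc_space_def)
  ultimately show "p \<in> span ((\<lambda>\<alpha>. single \<alpha> 1) ` mons e)" by simp
qed (auto simp: mons_def single_in_trunc_space)


section \<open>Commuting symmetric operators\<close>

text \<open>
  The Cauchy-Schwarz inequality in its degenerate case: a vector of length zero is orthogonal to
  everything, since otherwise \<open>B (s x + y) (s x + y)\<close> would be affine and nonconstant in \<open>s\<close>.
\<close>

lemma psd_form_null:
  fixes B :: "'a::real_vector \<Rightarrow> 'a \<Rightarrow> real"
  assumes bil: "bilinear B" and U: "subspace U"
    and sym: "\<And>x y. x \<in> U \<Longrightarrow> y \<in> U \<Longrightarrow> B x y = B y x"
    and nn: "\<And>x. x \<in> U \<Longrightarrow> 0 \<le> B x x"
    and x: "x \<in> U" "B x x = 0" and y: "y \<in> U"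
  shows "B x y = 0"
proof (rule ccontr)
  assume ne: "B x y \<noteq> 0"
  \<comment> \<open>chosen such that the affine function \<open>2 s B x y + B y y\<close> takes the value \<open>-1\<close>\<close>
  define s where "s = - (B y y + 1) / (2 * B x y)"
  have "0 \<le> B (s *\<^sub>R x + y) (s *\<^sub>R x + y)"
    using U x y by (intro nn) (auto simp: subspace_add subspace_scale)
  also have "\<dots> = 2 * s * B x y + B y y"
    using x(2) sym[OF x(1) y]
    by (simp add: bilinear_ladd[OF bil] bilinear_radd[OF bil] bilinear_lmul[OF bil]
        bilinear_rmul[OF bil])
  also have "\<dots> = - 1" using ne by (simp add: s_def field_simps)
  finally show False by simp
qed

text \<open>
  A maximizer \<open>x\<close> of the Rayleigh quotient is an eigenvector: with \<open>l\<close> the maximum, the form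
  \<open>l B(y, z) - B(T y, z)\<close> is positive semidefinite and vanishes at \<open>(x, x)\<close>, hence \<open>l x - T x\<close> is
  orthogonal to everything. The type carries no Euclidean structure, so the maximum is taken over
  the coordinates with respect to a basis \<open>S\<close>, in the unit sphere \<open>K\<close> of the space of functions
  on \<open>S\<close> with the product topology.
\<close>

lemma symmetric_operator_has_eigenvector:
  fixes B :: "'a::real_vector \<Rightarrow> 'a \<Rightarrow> real" and T :: "'a \<Rightarrow> 'a"
  assumes bil: "bilinear B" and U: "subspace U" "U \<subseteq> span A" "finite A" "U \<noteq> {0}"
    and sym: "\<And>x y. x \<in> U \<Longrightarrow> y \<in> U \<Longrightarrow> B x y = B y x"
    and pos: "\<And>x. x \<in> U \<Longrightarrow> x \<noteq> 0 \<Longrightarrow> 0 < B x x"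
    and T: "linear T" "\<And>x. x \<in> U \<Longrightarrow> T x \<in> U"
    and Tsym: "\<And>x y. x \<in> U \<Longrightarrow> y \<in> U \<Longrightarrow> B (T x) y = B x (T y)"
  shows "\<exists>x\<in>U. \<exists>\<mu>. x \<noteq> 0 \<and> T x = \<mu> *\<^sub>R x"
proof -
  obtain S where S: "S \<subseteq> U" "independent S" "U \<subseteq> span S"
    using maximal_independent_subset by blast
  have finS: "finite S"
    using independent_span_bound[OF U(3) S(2)] S(1) U(2) by auto
  have Uspan: "span S = U" using S U(1) by (simp add: span_minimal subset_antisym)
  define X :: "('a \<Rightarrow> real) \<Rightarrow> 'a" where "X v = (\<Sum>b\<in>S. v b *\<^sub>R b)" for v
  define K where "K = {v \<in> Pi\<^sub>E S (\<lambda>_. {-1..1::real}). (\<Sum>b\<in>S. (v b)\<^sup>2) = 1}"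
  have XU: "X v \<in> U" for v
    unfolding X_def using S(1) U(1) by (intro subspace_sum subspace_scale) auto
  have X0: "X v \<noteq> 0" if "v \<in> K" for v
  proof
    assume "X v = 0"
    hence "\<forall>b\<in>S. v b = 0"
      using S(2) finS independentD[of S S v] by (auto simp: X_def)
    thus False using that by (simp add: K_def)
  qed
  have Xex: "\<exists>v\<in>K. \<exists>s. x = s *\<^sub>R X v" if "x \<in> U" "x \<noteq> 0" for x
  proof -
    have "x \<in> range X"
      using that(1) span_finite[OF finS] unfolding Uspan X_def by (rule subst[rotated])
    then obtain u where u: "x = X u" by blast
    have u0: "\<exists>b\<in>S. u b \<noteq> 0"
    proof (rule ccontr)
      assume "\<not> (\<exists>b\<in>S. u b \<noteq> 0)"
      hence "X u = 0" by (simp add: X_def)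
      thus False using that(2) u by simp
    qed
    define s where "s = sqrt (\<Sum>b\<in>S. (u b)\<^sup>2)"
    have s2: "s\<^sup>2 = (\<Sum>b\<in>S. (u b)\<^sup>2)"
      by (simp add: s_def sum_nonneg)
    have sp: "0 < s"
      using u0 finS by (auto simp: s_def intro!: sum_pos2)
    define v where "v = restrict (\<lambda>b. u b / s) S"
    have "(\<Sum>b\<in>S. (v b)\<^sup>2) = (\<Sum>b\<in>S. (u b)\<^sup>2) / s\<^sup>2"
      by (simp add: v_def power_divide sum_divide_distrib)
    also have "\<dots> = 1" using sp unfolding s2[symmetric] by simp
    finally have sumv: "(\<Sum>b\<in>S. (v b)\<^sup>2) = 1" .
    have "v b \<in> {-1..1}" if b: "b \<in> S" for b
    proof -
      have "(v b)\<^sup>2 \<le> (\<Sum>b\<in>S. (v b)\<^sup>2)" by (intro member_le_sum b finS) auto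
      hence "\<bar>v b\<bar> \<le> 1" unfolding sumv by (simp add: abs_square_le_1)
      thus ?thesis by (simp add: abs_le_iff)
    qed
    hence "v \<in> Pi\<^sub>E S (\<lambda>_. {-1..1})"
      by (intro PiE_I) (auto simp: v_def)
    hence "v \<in> K" using sumv by (simp add: K_def)
    moreover have "x = s *\<^sub>R X v"
      using sp by (simp add: u X_def v_def scaleR_right.sum)
    ultimately show ?thesis by blast
  qed
  have cont: "continuous_on UNIV (\<lambda>v. C (X v) (X v))" if C: "bilinear C" for C :: "'a \<Rightarrow> 'a \<Rightarrow> real"
  proof -
    have "C (X v) (X v) = (\<Sum>(b, b')\<in>S \<times> S. v b' * (v b * C b b'))" for v
      unfolding X_def bilinear_sum[OF C]
      by (simp add: bilinear_lmul[OF C] bilinear_rmul[OF C])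
    moreover have "continuous_on UNIV (\<lambda>v::'a \<Rightarrow> real. \<Sum>(b, b')\<in>S \<times> S. v b' * (v b * C b b'))"
      unfolding case_prod_beta by (intro continuous_intros continuous_on_product_coordinates)
    ultimately show ?thesis by simp
  qed
  have compK: "compact K"
  proof -
    \<comment> \<open>off \<open>S\<close>, extensional functions have the fixed value \<open>undefined\<close>, a compact factor of the product\<close>
    have "Pi\<^sub>E S (\<lambda>_. {-1..1::real}) = Pi\<^sub>E UNIV (\<lambda>b. if b \<in> S then {-1..1} else {undefined})"
      unfolding PiE_def Pi_def extensional_def by (intro Collect_cong set_eqI) (auto split: if_splits)
    hence "compact (Pi\<^sub>E S (\<lambda>_. {-1..1::real}))"
      using compactin_PiE[of "\<lambda>_. euclidean" UNIV "\<lambda>b. if b \<in> S then {-1..1::real} else {undefined}"]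
      by (simp add: euclidean_product_topology)
    moreover have "closed {v. (\<Sum>b\<in>S. (v b :: real)\<^sup>2) = 1}"
      by (intro closed_Collect_eq continuous_intros continuous_on_product_coordinates)
    moreover have "K = Pi\<^sub>E S (\<lambda>_. {-1..1}) \<inter> {v. (\<Sum>b\<in>S. (v b)\<^sup>2) = 1}"
      by (auto simp: K_def)
    ultimately show ?thesis by (simp add: compact_Int_closed)
  qed
  have bilT: "bilinear (\<lambda>x y. B (T x) y)"
    using bil T(1) unfolding bilinear_def by (auto intro: linear_compose[of T, unfolded o_def])
  obtain x0 where x0: "x0 \<in> U" "x0 \<noteq> 0" using U(1,4) subspace_0 by blast
  hence "K \<noteq> {}" using Xex by blast
  moreover have "continuous_on K (\<lambda>v. B (T (X v)) (X v) / B (X v) (X v))"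
  proof (intro continuous_intros continuous_on_subset[OF cont[OF bil]]
      continuous_on_subset[OF cont[OF bilT]] subset_UNIV ballI)
    show "B (X v) (X v) \<noteq> 0" if "v \<in> K" for v
      using pos[OF XU X0[OF that]] by simp
  qed
  ultimately obtain v where v: "v \<in> K"
    and vmax: "\<And>u. u \<in> K \<Longrightarrow> B (T (X u)) (X u) / B (X u) (X u) \<le> B (T (X v)) (X v) / B (X v) (X v)"
    using continuous_attains_sup[OF compK] by blast
  define x where "x = X v"
  define l where "l = B (T x) x / B x x"
  have x: "x \<in> U" "x \<noteq> 0" using XU X0 v by (auto simp: x_def)
  have ray: "B (T y) y \<le> l * B y y" if y: "y \<in> U" for y
  proof (cases "y = 0")
    case True
    thus ?thesis by (simp add: bilinear_rzero[OF bil])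
  next
    case False
    then obtain u s where u: "u \<in> K" "y = s *\<^sub>R X u" using Xex y by blast
    have "B (T (X u)) (X u) \<le> l * B (X u) (X u)"
      using vmax[OF u(1)] pos[OF XU X0[OF u(1)]] by (simp add: l_def x_def divide_le_eq)
    hence "s\<^sup>2 * B (T (X u)) (X u) \<le> s\<^sup>2 * (l * B (X u) (X u))"
      by (intro mult_left_mono) auto
    thus ?thesis
      by (simp add: u(2) linear_scale[OF T(1)] bilinear_lmul[OF bil] bilinear_rmul[OF bil]
          power2_eq_square mult_ac)
  qed
  define C where "C y z = l * B y z - B (T y) z" for y z
  have Cbil: "bilinear C"
    unfolding bilinear_def C_def
    by (intro conjI allI linearI)
       (simp_all add: algebra_simps bilinear_ladd[OF bil] bilinear_radd[OF bil] bilinear_lmul[OF bil]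
        bilinear_rmul[OF bil] linear_scale[OF T(1)] linear_add[OF T(1)])
  have "C x x = 0" using pos[OF x] by (simp add: C_def l_def)
  hence Cx: "C x y = 0" if "y \<in> U" for y
    using psd_form_null[OF Cbil U(1) _ _ x(1) _ that] sym Tsym ray T(2) by (simp add: C_def)
  define r where "r = l *\<^sub>R x - T x"
  have rU: "r \<in> U" using x T(2) U(1) by (simp add: r_def subspace_diff subspace_scale)
  hence "B r r = 0"
    using Cx[OF rU] by (simp add: C_def) (simp add: r_def bilinear_lsub[OF bil] bilinear_lmul[OF bil])
  hence "r = 0" using pos[OF rU] by force
  hence "T x = l *\<^sub>R x" by (simp add: r_def)
  thus ?thesis using x by blast
qed

text \<open>
  Treat the operators one at a time: the eigenspace of the next operator inside the space found so
  far is again invariant under all of them, because they commute.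
\<close>

lemma commuting_symmetric_operators_have_joint_eigenvector:
  fixes B :: "'a::real_vector \<Rightarrow> 'a \<Rightarrow> real" and T :: "'i::finite \<Rightarrow> 'a \<Rightarrow> 'a"
  assumes bil: "bilinear B" and U: "subspace U" "U \<subseteq> span A" "finite A" "U \<noteq> {0}"
    and sym: "\<And>x y. x \<in> U \<Longrightarrow> y \<in> U \<Longrightarrow> B x y = B y x"
    and pos: "\<And>x. x \<in> U \<Longrightarrow> x \<noteq> 0 \<Longrightarrow> 0 < B x x"
    and T: "\<And>i. linear (T i)" "\<And>i x. x \<in> U \<Longrightarrow> T i x \<in> U"
    and Tsym: "\<And>i x y. x \<in> U \<Longrightarrow> y \<in> U \<Longrightarrow> B (T i x) y = B x (T i y)"
    and comm: "\<And>i j x. x \<in> U \<Longrightarrow> T i (T j x) = T j (T i x)"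
  shows "\<exists>x\<in>U. x \<noteq> 0 \<and> (\<forall>i. \<exists>\<mu>. T i x = \<mu> *\<^sub>R x)"
proof -
  have "\<exists>V\<subseteq>U. subspace V \<and> V \<noteq> {0} \<and> (\<forall>i. \<forall>x\<in>V. T i x \<in> V) \<and>
          (\<forall>i\<in>J. \<exists>\<mu>. \<forall>x\<in>V. T i x = \<mu> *\<^sub>R x)" for J :: "'i set"
    using finite[of J]
  proof (induction J rule: finite_induct)
    case empty
    show ?case by (intro exI[of _ U] conjI allI ballI order_refl U(1,4) T(2)) auto
  next
    case (insert j J)
    then obtain V where V: "V \<subseteq> U" "subspace V" "V \<noteq> {0}" "\<And>i x. x \<in> V \<Longrightarrow> T i x \<in> V"
      and VJ: "\<And>i. i \<in> J \<Longrightarrow> \<exists>\<mu>. \<forall>x\<in>V. T i x = \<mu> *\<^sub>R x" by blast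
    have VA: "V \<subseteq> span A" and VU: "\<And>x. x \<in> V \<Longrightarrow> x \<in> U" using V(1) U(2) by auto
    have "\<exists>x\<in>V. \<exists>\<mu>. x \<noteq> 0 \<and> T j x = \<mu> *\<^sub>R x"
      by (rule symmetric_operator_has_eigenvector[OF bil V(2) VA U(3) V(3)])
         (fact sym[OF VU VU] pos[OF VU] T(1) V(4) Tsym[OF VU VU])+
    then obtain x l where x: "x \<in> V" "x \<noteq> 0" "T j x = l *\<^sub>R x" by blast
    define V' where "V' = {y \<in> V. T j y = l *\<^sub>R y}"
    have "subspace V'"
      using V(2) by (auto simp: V'_def subspace_def linear_0[OF T(1)] linear_add[OF T(1)]
          linear_scale[OF T(1)] scaleR_add_right)
    moreover have "T i y \<in> V'" if "y \<in> V'" for i y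
    proof -
      have y: "y \<in> V" "T j y = l *\<^sub>R y" using that by (auto simp: V'_def)
      have "T j (T i y) = T i (T j y)" by (rule comm[OF VU[OF y(1)]])
      also have "\<dots> = l *\<^sub>R T i y" by (simp add: y(2) linear_scale[OF T(1)])
      finally show ?thesis using V(4)[OF y(1)] by (simp add: V'_def)
    qed
    moreover have "V' \<noteq> {0}" using x by (auto simp: V'_def)
    moreover have "\<exists>\<mu>. \<forall>x\<in>V'. T i x = \<mu> *\<^sub>R x" if "i \<in> insert j J" for i
    proof (cases "i = j")
      case False
      hence "i \<in> J" using that by simp
      from VJ[OF this] obtain \<mu> where "\<forall>x\<in>V. T i x = \<mu> *\<^sub>R x" ..
      thus ?thesis by (auto simp: V'_def)
    qed (auto simp: V'_def)
    moreover have "V' \<subseteq> U" using VU by (auto simp: V'_def)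
    ultimately have "V' \<subseteq> U \<and> subspace V' \<and> V' \<noteq> {0} \<and> (\<forall>i. \<forall>x\<in>V'. T i x \<in> V') \<and>
          (\<forall>i\<in>insert j J. \<exists>\<mu>. \<forall>x\<in>V'. T i x = \<mu> *\<^sub>R x)"
      by simp
    thus ?case ..
  qed
  from this[of UNIV] obtain V where "V \<subseteq> U \<and> subspace V \<and> V \<noteq> {0} \<and>
      (\<forall>i. \<forall>x\<in>V. T i x \<in> V) \<and> (\<forall>i\<in>UNIV. \<exists>\<mu>. \<forall>x\<in>V. T i x = \<mu> *\<^sub>R x)" ..
  hence V: "V \<subseteq> U" "subspace V" "V \<noteq> {0}" "\<And>i. \<exists>\<mu>. \<forall>x\<in>V. T i x = \<mu> *\<^sub>R x" by simp_all
  obtain x where x: "x \<in> V" "x \<noteq> 0" using V(3) subspace_0[OF V(2)] by blast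
  have "\<exists>\<mu>. T i x = \<mu> *\<^sub>R x" for i using V(4)[of i] x(1) by auto
  thus ?thesis using x V(1) by (intro bexI[of _ x] conjI allI) auto
qed

text \<open>
  Take an orthonormal set of joint eigenvectors of largest cardinality. Its orthogonal complement is
  invariant by symmetry, so if it were nonzero it would contain a further joint eigenvector.
\<close>

lemma commuting_symmetric_operators_have_joint_eigenbasis:
  fixes B :: "'a::real_vector \<Rightarrow> 'a \<Rightarrow> real" and T :: "'i::finite \<Rightarrow> 'a \<Rightarrow> 'a"
  assumes bil: "bilinear B" and U: "subspace U" "U \<subseteq> span A" "finite A"
    and sym: "\<And>x y. x \<in> U \<Longrightarrow> y \<in> U \<Longrightarrow> B x y = B y x"
    and pos: "\<And>x. x \<in> U \<Longrightarrow> x \<noteq> 0 \<Longrightarrow> 0 < B x x"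
    and T: "\<And>i. linear (T i)" "\<And>i x. x \<in> U \<Longrightarrow> T i x \<in> U"
    and Tsym: "\<And>i x y. x \<in> U \<Longrightarrow> y \<in> U \<Longrightarrow> B (T i x) y = B x (T i y)"
    and comm: "\<And>i j x. x \<in> U \<Longrightarrow> T i (T j x) = T j (T i x)"
  shows "\<exists>F\<subseteq>U. finite F \<and> (\<forall>e\<in>F. \<forall>e'\<in>F. B e e' = (if e = e' then 1 else 0)) \<and>
           (\<forall>e\<in>F. \<forall>i. \<exists>\<mu>. T i e = \<mu> *\<^sub>R e) \<and> (\<forall>x\<in>U. x = (\<Sum>e\<in>F. B x e *\<^sub>R e))"
proof -
  define P where "P F \<longleftrightarrow> F \<subseteq> U \<and> finite F \<and>
      (\<forall>e\<in>F. \<forall>e'\<in>F. B e e' = (if e = e' then 1 else 0)) \<and>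
      (\<forall>e\<in>F. \<forall>i. \<exists>\<mu>. T i e = \<mu> *\<^sub>R e)" for F
  have coord: "B (\<Sum>e\<in>F. u e *\<^sub>R e) e' = u e'" if "P F" "e' \<in> F" for F u e'
  proof -
    have "B (\<Sum>e\<in>F. u e *\<^sub>R e) e' = (\<Sum>e\<in>F. u e * B e e')"
      using linear_sum[of "\<lambda>x. B x e'" "\<lambda>e. u e *\<^sub>R e" F] bil
      by (simp add: bilinear_def bilinear_lmul[OF bil])
    also have "\<dots> = (\<Sum>e\<in>F. if e = e' then u e' else 0)"
      using that by (intro sum.cong) (auto simp: P_def)
    finally show ?thesis using that by (simp add: P_def)
  qed
  have bound: "card F \<le> card A" if F: "P F" for F
  proof -
    have finF: "finite F" "F \<subseteq> U" using F by (auto simp: P_def)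
    have "u e = 0" if "(\<Sum>e\<in>F. u e *\<^sub>R e) = 0" "e \<in> F" for u e
      using coord[OF F that(2), of u] that(1) by (simp add: bilinear_lzero[OF bil])
    hence "independent F"
      unfolding dependent_finite[OF finF(1)] by blast
    thus ?thesis using independent_span_bound[OF U(3)] finF(2) U(2) by blast
  qed
  have "P {}" by (simp add: P_def)
  then obtain F where F: "P F" and Fmax: "\<And>F'. P F' \<Longrightarrow> card F' \<le> card F"
    using ex_has_greatest_nat[of P "{}" card "Suc (card A)"] bound by (metis le_imp_less_Suc)
  have FU: "F \<subseteq> U" "finite F" using F by (auto simp: P_def)
  define V where "V = {x \<in> U. \<forall>e\<in>F. B x e = 0}"
  have Vsub: "subspace V"
    using U(1) by (auto simp: V_def subspace_def bilinear_lzero[OF bil] bilinear_ladd[OF bil]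
        bilinear_lmul[OF bil])
  have VT: "T i x \<in> V" if x: "x \<in> V" for i x
  proof -
    have "B (T i x) e = 0" if e: "e \<in> F" for e
    proof -
      have "\<exists>\<mu>. T i e = \<mu> *\<^sub>R e" using F e by (simp add: P_def)
      then obtain l where "T i e = l *\<^sub>R e" ..
      thus ?thesis using x e FU Tsym[of x e i]
        by (auto simp: V_def bilinear_rmul[OF bil])
    qed
    thus ?thesis using x T(2) by (auto simp: V_def)
  qed
  have VA: "V \<subseteq> span A" and VU: "\<And>x. x \<in> V \<Longrightarrow> x \<in> U" using U(2) by (auto simp: V_def)
  have V0: "V = {0}"
  proof (rule ccontr)
    assume "V \<noteq> {0}"
    hence "\<exists>x\<in>V. x \<noteq> 0 \<and> (\<forall>i. \<exists>\<mu>. T i x = \<mu> *\<^sub>R x)"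
      by (rule commuting_symmetric_operators_have_joint_eigenvector[OF bil Vsub VA U(3)])
         (fact sym[OF VU VU] pos[OF VU] T(1) VT Tsym[OF VU VU] comm[OF VU])+
    then obtain x where x: "x \<in> V" "x \<noteq> 0" and xT: "\<And>i. \<exists>\<mu>. T i x = \<mu> *\<^sub>R x" by blast
    have xp: "0 < B x x" using x pos by (auto simp: V_def)
    define e where "e = (1 / sqrt (B x x)) *\<^sub>R x"
    have eV: "e \<in> V" using x Vsub by (simp add: e_def subspace_scale)
    have ee: "B e e = 1"
      using xp by (simp add: e_def bilinear_lmul[OF bil] bilinear_rmul[OF bil] field_simps
          flip: real_sqrt_mult)
    have eT: "\<exists>\<mu>. T i e = \<mu> *\<^sub>R e" for i
    proof -
      obtain l where "T i x = l *\<^sub>R x" using xT by blast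
      hence "T i e = l *\<^sub>R e" by (simp add: e_def linear_scale[OF T(1)])
      thus ?thesis by blast
    qed
    have eF: "B e e' = 0" "B e' e = 0" if "e' \<in> F" for e'
      using eV that FU sym[of e e'] by (auto simp: V_def)
    hence "e \<notin> F" using ee by force
    moreover have "P (insert e F)"
      using F ee eT eF eV by (auto simp: P_def V_def)
    ultimately show False using Fmax[of "insert e F"] FU by simp
  qed
  have expand: "x = (\<Sum>e\<in>F. B x e *\<^sub>R e)" if x: "x \<in> U" for x
  proof -
    have "x - (\<Sum>e\<in>F. B x e *\<^sub>R e) \<in> V"
      using x FU U(1) coord[OF F]
      by (auto simp: V_def bilinear_lsub[OF bil] intro!: subspace_diff subspace_sum subspace_scale)
    thus ?thesis using V0 by simp
  qed
  show ?thesis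
    using F unfolding P_def by (elim conjE, intro exI[of _ F] conjI ballI expand) blast+
qed


section \<open>Flat extensions of moment sequences\<close>

text \<open>
  Polynomials form an infinite-dimensional space, so the next two facts are needed for finite subsets
  of an arbitrary real vector space.
\<close>

lemma dim_image_le_finite:
  fixes f :: "'a::real_vector \<Rightarrow> 'b::real_vector"
  assumes "linear f" "finite S"
  shows "dim (f ` S) \<le> dim S"
proof -
  obtain B where B: "B \<subseteq> S" "independent B" "S \<subseteq> span B" "card B = dim S"
    by (rule real_vector.basis_exists)
  have "finite B" using B(1) assms(2) finite_subset by blast
  moreover have "f ` S \<subseteq> span (f ` B)"
    using B(3) unfolding linear_span_image[OF assms(1)] by blast
  ultimately have "dim (f ` S) \<le> card (f ` B)"
    by (intro real_vector.dim_le_card) auto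
  also have "\<dots> \<le> card B" using \<open>finite B\<close> by (rule card_image_le)
  finally show ?thesis using B(4) by simp
qed

lemma span_eq_of_dim_le:
  fixes S T :: "'a::real_vector set"
  assumes "S \<subseteq> T" "finite T" "dim T \<le> dim S"
  shows "span S = span T"
proof -
  obtain B where B: "B \<subseteq> S" "independent B" "S \<subseteq> span B" "card B = dim S"
    by (rule real_vector.basis_exists)
  obtain C where C: "C \<subseteq> T" "independent C" "T \<subseteq> span C" "card C = dim T"
    by (rule real_vector.basis_exists)
  have fin: "finite B" "finite C" using B(1) C(1) assms(1,2) by (meson finite_subset)+
  have "T \<subseteq> span B"
  proof (rule ccontr)
    assume "\<not> T \<subseteq> span B"
    then obtain x where x: "x \<in> T" "x \<notin> span B" by blast
    have "independent (insert x B)" using x(2) B(2) by (simp add: independent_insert)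
    moreover have "insert x B \<subseteq> span C" using x(1) B(1) C(3) assms(1) by blast
    ultimately have "card (insert x B) \<le> card C"
      using independent_span_bound[OF fin(2)] by blast
    moreover have "x \<notin> B" using x(2) span_base by blast
    ultimately show False using fin(1) assms(3) B(4) C(4) by simp
  qed
  hence "T \<subseteq> span S" using span_mono[OF B(1)] by blast
  thus ?thesis using assms(1) by (intro antisym span_mono span_minimal) auto
qed

definition moment_form :: "('v::finite) tms \<Rightarrow> 'v rpoly \<Rightarrow> 'v rpoly \<Rightarrow> real"
  where "moment_form z p q = pairing (p * q) z"

lemma scaleR_mult_left: "c *\<^sub>R p * q = c *\<^sub>R (p * q)" for p q :: "('v::finite) rpoly"
  by (simp add: scaleR_conv_mult mult.assoc)

lemma scaleR_mult_right: "p * c *\<^sub>R q = c *\<^sub>R (p * q)" for p q :: "('v::finite) rpoly"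
  by (simp add: scaleR_conv_mult mult_ac)

lemma bilinear_moment_form: "bilinear (moment_form z)"
  unfolding bilinear_def moment_form_def
  by (intro conjI allI linearI)
     (simp_all add: distrib_left distrib_right pairing_add scaleR_mult_left scaleR_mult_right pairing_scaleR)

lemma moment_form_commute: "moment_form z p q = moment_form z q p"
  by (simp add: moment_form_def mult.commute)

text \<open>
  Multiplication by a polynomial is symmetric for the moment form; this is the Hankel structure of
  the moment matrix.
\<close>

lemma moment_form_shift: "moment_form z (r * p) q = moment_form z p (r * q)"
  by (simp add: moment_form_def mult_ac)

lemma moment_form_expand: "moment_form z p q = (\<Sum>\<alpha>\<in>keys q. lookup q \<alpha> * moment_form z p (single \<alpha> 1))"
proof -
  have "single \<alpha> (lookup q \<alpha>) = lookup q \<alpha> *\<^sub>R single \<alpha> 1" for \<alpha>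
    by (rule poly_mapping_eqI) (simp add: lookup_scaleR lookup_single when_def)
  hence "p * q = (\<Sum>\<alpha>\<in>keys q. lookup q \<alpha> *\<^sub>R (p * single \<alpha> 1))"
    by (subst poly_mapping_decomp[of q]) (simp add: sum_distrib_left scaleR_mult_right)
  thus ?thesis by (simp add: moment_form_def pairing_sum pairing_scaleR)
qed

text \<open>
  The value of the quadratic form of the localizing matrix at the coefficient vector of \<open>p\<close>.
\<close>

lemma loc_psd_square_nonneg:
  assumes L: "loc_psd k q z" and p: "p \<in> trunc_space s" and s: "s + half_up (pdeg q) \<le> k"
  shows "0 \<le> pairing (q * p * p) z"
proof -
  let ?I = "loc_index k q"
  have fin: "finite ?I"
    by (rule finite_subset[OF _ finite_mons[of k]]) (auto simp: loc_index_def mons_def)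
  have sub: "keys p \<subseteq> ?I" using p s by (auto simp: loc_index_def mem_trunc_space_iff)
  have "0 \<le> (\<Sum>\<alpha>\<in>?I. \<Sum>\<beta>\<in>?I. lookup p \<alpha> * loc_mat q z \<alpha> \<beta> * lookup p \<beta>)"
    using L by (simp add: loc_psd_def psd_def)
  also have "\<dots> = (\<Sum>\<alpha>\<in>keys p. \<Sum>\<beta>\<in>?I. lookup p \<alpha> * loc_mat q z \<alpha> \<beta> * lookup p \<beta>)"
    by (rule sum.mono_neutral_right[OF fin sub]) (simp add: in_keys_iff)
  also have "\<dots> = (\<Sum>\<alpha>\<in>keys p. \<Sum>\<beta>\<in>keys p. lookup p \<alpha> * loc_mat q z \<alpha> \<beta> * lookup p \<beta>)"
    by (intro sum.cong refl sum.mono_neutral_right[OF fin sub]) (simp add: in_keys_iff)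
  also have "\<dots> = pairing (q * p * p) z" by (rule loc_mat_bilinear)
  finally show ?thesis .
qed

text \<open>
  A principal submatrix of a positive semidefinite matrix is positive semidefinite.
\<close>

lemma loc_psd_mono:
  assumes "loc_psd k q z" "l \<le> k"
  shows "loc_psd l q z"
  unfolding loc_psd_def psd_def
proof (intro conjI ballI allI)
  have fin: "finite (loc_index k q)"
    by (rule finite_subset[OF _ finite_mons[of k]]) (auto simp: loc_index_def mons_def)
  have sub: "loc_index l q \<subseteq> loc_index k q" using assms(2) by (auto simp: loc_index_def)
  show "loc_mat q z \<alpha> \<beta> = loc_mat q z \<beta> \<alpha>" for \<alpha> \<beta>
    by (simp add: loc_mat_def mult_ac)
  fix v :: "'a mon \<Rightarrow> real"
  let ?v = "\<lambda>\<alpha>. if \<alpha> \<in> loc_index l q then v \<alpha> else 0"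
  have "0 \<le> (\<Sum>\<alpha>\<in>loc_index k q. \<Sum>\<beta>\<in>loc_index k q. ?v \<alpha> * loc_mat q z \<alpha> \<beta> * ?v \<beta>)"
    using assms(1) unfolding loc_psd_def psd_def by (elim conjE allE[of _ ?v])
  also have "\<dots> = (\<Sum>\<alpha>\<in>loc_index l q. \<Sum>\<beta>\<in>loc_index k q. ?v \<alpha> * loc_mat q z \<alpha> \<beta> * ?v \<beta>)"
    by (rule sum.mono_neutral_right[OF fin sub]) simp
  also have "\<dots> = (\<Sum>\<alpha>\<in>loc_index l q. \<Sum>\<beta>\<in>loc_index l q. ?v \<alpha> * loc_mat q z \<alpha> \<beta> * ?v \<beta>)"
    by (intro sum.cong refl sum.mono_neutral_right[OF fin sub]) simp
  finally show "0 \<le> (\<Sum>\<alpha>\<in>loc_index l q. \<Sum>\<beta>\<in>loc_index l q. v \<alpha> * loc_mat q z \<alpha> \<beta> * v \<beta>)"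
    by simp
qed

lemma moment_psd_iff_loc_psd: "moment_psd k z \<longleftrightarrow> loc_psd k 1 z"
proof -
  have "pdeg (1 :: 'a rpoly) = 0" by (simp add: pdeg_def)
  thus ?thesis
    by (simp add: moment_psd_def loc_psd_def loc_mat_one loc_index_def mons_def half_up_def)
qed

lemma moment_psd_moment_form_nonneg:
  assumes "moment_psd k z" "p \<in> trunc_space k"
  shows "0 \<le> moment_form z p p"
  using loc_psd_square_nonneg[of k 1 z p k] assms
  by (simp add: moment_psd_iff_loc_psd moment_form_def pdeg_def half_up_def)

text \<open>
  For \<open>p\<close> of degree at most \<open>k\<close>, the product of the moment matrix with the coefficient vector of \<open>p\<close>. Its kernel on polynomials of
  degree at most \<open>k\<close> is the kernel of the moment form, so \<open>moment_col k z\<close> serves as the quotient map.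
\<close>

definition moment_col :: "nat \<Rightarrow> ('v::finite) tms \<Rightarrow> 'v rpoly \<Rightarrow> 'v tms"
  where "moment_col k z p = tvec k (\<lambda>\<alpha>. moment_form z p (single \<alpha> 1))"

lemma linear_moment_col: "linear (moment_col k z)"
  by (rule linearI; rule poly_mapping_eqI)
     (simp_all add: moment_col_def lookup_tvec lookup_add lookup_scaleR bilinear_ladd[OF bilinear_moment_form]
       bilinear_lmul[OF bilinear_moment_form])

lemma linear_trunc: "linear (trunc e)"
  by (rule linearI; rule poly_mapping_eqI)
     (simp_all add: trunc_def lookup_tvec lookup_add lookup_scaleR)

lemma moment_rank_eq_dim: "moment_rank k z = dim (moment_col k z ` (\<lambda>\<alpha>. single \<alpha> 1) ` mons k)"
proof -
  have "(\<Sum>i\<in>mons k. single i (moment_mat z i j)) = moment_col k z (single j 1)" for j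
    by (simp add: moment_col_def tvec_def moment_form_def moment_mat_def mult_single pairing_single add.commute)
  thus ?thesis by (simp add: moment_rank_def mat_rank_def image_image)
qed

lemma moment_form_eq_if_moment_col_eq:
  assumes "moment_col k z p = moment_col k z p'" "q \<in> trunc_space k"
  shows "moment_form z p q = moment_form z p' q"
proof -
  have "moment_form z p (single \<alpha> 1) = moment_form z p' (single \<alpha> 1)" if "mdeg \<alpha> \<le> k" for \<alpha>
    using arg_cong[OF assms(1), of "\<lambda>y. lookup y \<alpha>"] that by (simp add: moment_col_def lookup_tvec mons_def)
  thus ?thesis
    using assms(2) unfolding moment_form_expand[of z _ q]
    by (intro sum.cong) (auto simp: mem_trunc_space_iff)
qed

text \<open>
  Deleting rows from the columns of degree at most \<open>s\<close> cannot increase their rank, and it already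
  leaves rank \<open>moment_rank s z\<close>; so these columns span all the others.
\<close>

lemma moment_col_image_eq_if_flat:
  assumes "moment_rank k z = moment_rank s z" "s \<le> k"
  shows "moment_col k z ` trunc_space k = moment_col k z ` trunc_space s"
proof -
  let ?X = "\<lambda>e. (\<lambda>\<alpha>. single \<alpha> 1) ` mons e"
  have "moment_col s z p = trunc s (moment_col k z p)" for p
    using assms(2) by (intro poly_mapping_eqI) (simp add: moment_col_def trunc_def lookup_tvec mons_def)
  hence "dim (moment_col s z ` ?X s) = dim (trunc s ` moment_col k z ` ?X s)"
    by (simp add: image_image)
  also have "\<dots> \<le> dim (moment_col k z ` ?X s)"
    by (intro dim_image_le_finite linear_trunc finite_imageI finite_mons)
  finally have "dim (moment_col k z ` ?X k) \<le> dim (moment_col k z ` ?X s)"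
    using assms(1) by (simp add: moment_rank_eq_dim)
  moreover have "moment_col k z ` ?X s \<subseteq> moment_col k z ` ?X k"
    using assms(2) by (intro image_mono) (auto simp: mons_def)
  ultimately have "span (moment_col k z ` ?X s) = span (moment_col k z ` ?X k)"
    by (intro span_eq_of_dim_le finite_imageI finite_mons)
  thus ?thesis by (simp add: linear_span_image[OF linear_moment_col] trunc_space_eq_span)
qed

abbreviation Var :: "'v::finite \<Rightarrow> 'v rpoly"
  where "Var i \<equiv> single (single i 1) 1"

text \<open>
  The elements of \<open>F\<close> are polynomials that represent an orthonormal basis of joint eigenvectors of the
  multiplication operators; they also index the atoms: \<open>u e\<close> is the tuple of eigenvalues of \<open>e\<close>, and
  its weight is the square of \<open>a e\<close>, the coordinate of the constant \<open>1\<close> along \<open>e\<close>. The moments come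
  out right because \<open>B(p, e) = a(e) p(u\<^sub>e)\<close>, by moving the variables of \<open>p\<close> one by one onto \<open>e\<close>,
  after which Parseval's identity evaluates \<open>B(p, q)\<close>. Taking an eigenvector for \<open>p\<close> gives the
  interpolation property in the last conclusion.
\<close>

theorem flat_extension:
  fixes z :: "('v::finite) tms"
  assumes psd: "moment_psd k z" and flat: "moment_rank k z = moment_rank s z" and s: "s < k"
  obtains F and a :: "'v rpoly \<Rightarrow> real" and u :: "'v rpoly \<Rightarrow> real ^ 'v"
  where "finite F" "F \<subseteq> trunc_space s"
    and "\<And>p. p \<in> trunc_space (2 * k) \<Longrightarrow> pairing p z = (\<Sum>e\<in>F. (a e)\<^sup>2 * peval p (u e))"
    and "\<And>e e'. e \<in> F \<Longrightarrow> e' \<in> F \<Longrightarrow> a e' * peval e (u e') = (if e = e' then 1 else 0)"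
proof -
  let ?B = "moment_form z" and ?Vk = "trunc_space k :: 'v rpoly set" and ?Vs = "trunc_space s :: 'v rpoly set"
  note bil = bilinear_moment_form[of z]
  have Vsk: "p \<in> ?Vk" if "p \<in> ?Vs" for p
    using that trunc_space_mono[of s k] s by auto
  have Xp: "Var i * p \<in> ?Vk" if "p \<in> trunc_space n" "n < k" for i p n
  proof -
    have "Var i * p \<in> trunc_space (1 + n)"
      using that(1) by (intro trunc_space_mult single_in_trunc_space) (auto simp: mdeg_single)
    thus ?thesis using trunc_space_mono[of "1 + n" k] that(2) by auto
  qed
  note XVs = Xp[OF _ s]
  \<comment> \<open>By flatness \<open>moment_col k z\<close> takes all its values already on degree \<open>s\<close>. Composing it with a linear right
    inverse \<open>r\<close> yields \<open>\<pi>\<close>, which replaces a polynomial by an equivalent one of degree at most \<open>s\<close>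
    modulo the kernel; the image \<open>W\<close> of \<open>\<pi>\<close> is a concrete model of the quotient.\<close>
  obtain r where r: "range r \<subseteq> ?Vs" "linear r" "\<And>y. y \<in> moment_col k z ` ?Vs \<Longrightarrow> moment_col k z (r y) = y"
    using linear_exists_right_inverse_on[OF linear_moment_col[of k z] subspace_trunc_space[of s]] by blast
  define \<pi> where "\<pi> p = r (moment_col k z p)" for p
  have \<pi>lin: "linear \<pi>"
    using linear_compose[OF linear_moment_col[of k z] r(2)] by (simp add: \<pi>_def[abs_def] o_def)
  have \<pi>Vs: "\<pi> p \<in> ?Vs" for p using r(1) by (auto simp: \<pi>_def)
  have moment_col\<pi>: "moment_col k z (\<pi> p) = moment_col k z p" if "p \<in> ?Vk" for p
    unfolding \<pi>_def using that s moment_col_image_eq_if_flat[OF flat] by (intro r(3)) auto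
  have B\<pi>: "?B (\<pi> p) q = ?B p q" if "p \<in> ?Vk" "q \<in> ?Vk" for p q
    by (rule moment_form_eq_if_moment_col_eq[OF moment_col\<pi> that(2)]) fact
  define W where "W = \<pi> ` ?Vk"
  have WVs: "w \<in> ?Vs" if "w \<in> W" for w using that \<pi>Vs by (auto simp: W_def)
  note WVk = Vsk[OF WVs]
  have Wsub: "subspace W"
    unfolding W_def by (intro linear_subspace_image[OF \<pi>lin] subspace_trunc_space)
  have \<pi>W: "\<pi> w = w" if "w \<in> W" for w
    using that moment_col\<pi> by (auto simp: W_def \<pi>_def)
  have Bpos: "0 < ?B w w" if w: "w \<in> W" "w \<noteq> 0" for w
  proof (rule ccontr)
    assume "\<not> 0 < ?B w w"
    hence "?B w w = 0" using moment_psd_moment_form_nonneg[OF psd WVk[OF w(1)]] by simp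
    hence "?B w q = 0" if "q \<in> ?Vk" for q
      using psd_form_null[OF bil subspace_trunc_space moment_form_commute
          moment_psd_moment_form_nonneg[OF psd] WVk[OF w(1)] _ that] by simp
    hence "moment_col k z w = 0"
      by (intro poly_mapping_eqI) (simp add: moment_col_def lookup_tvec mons_def single_in_trunc_space)
    hence "\<pi> w = 0" by (simp add: \<pi>_def linear_0[OF r(2)])
    thus False using \<pi>W w by simp
  qed
  \<comment> \<open>multiplication by a variable raises the degree to at most \<open>s + 1 \<le> k\<close>, where \<open>\<pi>\<close> still applies\<close>
  define T where "T i p = \<pi> (Var i * p)" for i :: 'v and p
  have Tlin: "linear (T i)" for i
    by (rule linearI)
       (simp_all add: T_def distrib_left scaleR_mult_right linear_add[OF \<pi>lin] linear_scale[OF \<pi>lin])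
  have TW: "T i w \<in> W" if "w \<in> W" for i w
    unfolding T_def W_def by (intro imageI XVs WVs that)
  have BT: "?B (T i w) q = ?B w (Var i * q)" if "w \<in> W" "q \<in> ?Vk" for i w q
    unfolding T_def using B\<pi>[OF XVs[OF WVs] that(2), OF that(1)] by (simp add: moment_form_shift)
  have Tsym: "?B (T i w) w' = ?B w (T i w')" if "w \<in> W" "w' \<in> W" for i w w'
    using BT[OF that(1) WVk[OF that(2)], of i] BT[OF that(2) WVk[OF that(1)], of i]
    by (metis moment_form_commute moment_form_shift)
  \<comment> \<open>both products have the same inner products with all of \<open>W\<close>, namely \<open>\<langle>X\<^sub>i X\<^sub>j w v, z\<rangle>\<close>\<close>
  have Tcomm: "T i (T j w) = T j (T i w)" if w: "w \<in> W" for i j w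
  proof -
    have eq: "?B (T i (T j w)) v = ?B (Var j * w) (Var i * v)" if v: "v \<in> W" for i j v
      using BT[OF TW[OF w] WVk[OF v]] BT[OF w XVs[OF WVs[OF v]]]
      by (simp add: moment_form_shift[symmetric])
    define v where "v = T i (T j w) - T j (T i w)"
    have v: "v \<in> W" using Wsub TW w by (simp add: v_def subspace_diff)
    have "?B v v = ?B (T i (T j w)) v - ?B (T j (T i w)) v"
      by (subst (1) v_def) (rule bilinear_lsub[OF bil])
    also have "\<dots> = 0" unfolding eq[OF v] by (simp add: moment_form_def mult_ac)
    finally show ?thesis using Bpos[OF v] by (auto simp: v_def)
  qed
  define A where "A = (\<lambda>\<alpha>. single \<alpha> (1::real)) ` (mons k :: 'v mon set)"
  have A: "W \<subseteq> span A" "finite A"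
    using WVk finite_mons by (auto simp: A_def trunc_space_eq_span[symmetric])
  have "\<exists>F\<subseteq>W. finite F \<and>
      (\<forall>e\<in>F. \<forall>e'\<in>F. ?B e e' = (if e = e' then 1 else 0)) \<and>
      (\<forall>e\<in>F. \<forall>i. \<exists>\<mu>. T i e = \<mu> *\<^sub>R e) \<and> (\<forall>x\<in>W. x = (\<Sum>e\<in>F. ?B x e *\<^sub>R e))"
  proof (rule commuting_symmetric_operators_have_joint_eigenbasis
      [where B = "moment_form z" and U = W and T = T and A = A])
    show "\<And>x y. ?B x y = ?B y x" by (rule moment_form_commute)
  qed (fact bil Wsub A Bpos Tlin TW Tsym Tcomm)+
  then obtain F where "F \<subseteq> W \<and> finite F \<and>
      (\<forall>e\<in>F. \<forall>e'\<in>F. ?B e e' = (if e = e' then 1 else 0)) \<and>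
      (\<forall>e\<in>F. \<forall>i. \<exists>\<mu>. T i e = \<mu> *\<^sub>R e) \<and> (\<forall>x\<in>W. x = (\<Sum>e\<in>F. ?B x e *\<^sub>R e))" ..
  hence F: "F \<subseteq> W" "finite F"
    and orth: "\<forall>e\<in>F. \<forall>e'\<in>F. ?B e e' = (if e = e' then 1 else 0)"
    and eig: "\<forall>e\<in>F. \<forall>i. \<exists>\<mu>. T i e = \<mu> *\<^sub>R e"
    and span: "\<forall>x\<in>W. x = (\<Sum>e\<in>F. ?B x e *\<^sub>R e)"
    by blast+
  have FW: "e \<in> W" if "e \<in> F" for e using F that by blast
  define u where "u e = (\<chi> i. SOME \<mu>. T i e = \<mu> *\<^sub>R e)" for e
  have Tu: "T i e = (u e $ i) *\<^sub>R e" if "e \<in> F" for i e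
    unfolding u_def using someI_ex[of "\<lambda>\<mu>. T i e = \<mu> *\<^sub>R e"] eig that by simp
  define a where "a e = ?B 1 e" for e
  have mono: "?B (single \<alpha> 1) e = a e * monom_val (u e) \<alpha>" if e: "e \<in> F" and "mdeg \<alpha> \<le> k" for e \<alpha>
    using that(2)
  proof (induction "mdeg \<alpha>" arbitrary: \<alpha>)
    case 0
    thus ?case using mdeg_eq_0_iff[of \<alpha>] by (simp add: a_def)
  next
    case (Suc n)
    obtain i \<beta> where \<alpha>: "\<alpha> = single i 1 + \<beta>" "mdeg \<beta> = n"
      using mdeg_Suc_decomp[OF Suc(2)[symmetric]] by blast
    have \<beta>V: "single \<beta> 1 \<in> ?Vk" using Suc \<alpha> by (intro single_in_trunc_space) auto
    have "?B (single \<alpha> 1) e = ?B e (Var i * single \<beta> 1)"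
      by (simp add: \<alpha> mult_single moment_form_commute)
    also have "\<dots> = ?B (T i e) (single \<beta> 1)"
      by (rule BT[OF FW[OF e] \<beta>V, symmetric])
    also have "\<dots> = u e $ i * ?B (single \<beta> 1) e"
      by (simp add: Tu[OF e] bilinear_lmul[OF bil] moment_form_commute[of z e])
    also have "?B (single \<beta> 1) e = a e * monom_val (u e) \<beta>"
      using Suc \<alpha> by auto
    finally show ?case by (simp add: \<alpha> monom_val_add monom_val_single del: One_nat_def)
  qed
  have poly: "?B p e = a e * peval p (u e)" if e: "e \<in> F" and p: "p \<in> ?Vk" for e p
  proof -
    have "?B p e = (\<Sum>\<alpha>\<in>keys p. lookup p \<alpha> * ?B (single \<alpha> 1) e)"
      using moment_form_expand[of z e p] by (simp add: moment_form_commute)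
    also have "\<dots> = (\<Sum>\<alpha>\<in>keys p. a e * (lookup p \<alpha> * monom_val (u e) \<alpha>))"
      using p mono[OF e] by (intro sum.cong) (auto simp: mem_trunc_space_iff)
    finally show ?thesis by (simp add: peval_def sum_distrib_left)
  qed
  have parseval: "?B p q = (\<Sum>e\<in>F. ?B p e * ?B q e)" if pq: "p \<in> ?Vk" "q \<in> ?Vk" for p q
  proof -
    have \<pi>p: "\<pi> p \<in> W" using pq by (simp add: W_def)
    have "?B p q = ?B q (\<pi> p)" using B\<pi>[OF pq] by (simp add: moment_form_commute)
    also have "\<pi> p = (\<Sum>e\<in>F. ?B (\<pi> p) e *\<^sub>R e)"
      by (rule bspec[OF span \<pi>p])
    also have "\<dots> = (\<Sum>e\<in>F. ?B p e *\<^sub>R e)"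
      using B\<pi>[OF pq(1) WVk[OF FW]] by (intro sum.cong) auto
    also have "?B q \<dots> = (\<Sum>e\<in>F. ?B p e * ?B q e)"
      using linear_sum[of "?B q" "\<lambda>e. ?B p e *\<^sub>R e" F] bil
      by (simp add: bilinear_def bilinear_rmul[OF bil])
    finally show ?thesis .
  qed
  have mom: "lookup z \<gamma> = (\<Sum>e\<in>F. (a e)\<^sup>2 * monom_val (u e) \<gamma>)" if \<gamma>: "mdeg \<gamma> \<le> 2 * k" for \<gamma>
  proof -
    obtain \<alpha> \<beta> where ab: "\<gamma> = \<alpha> + \<beta>" "mdeg \<alpha> \<le> k" "mdeg \<beta> \<le> k"
      using mdeg_split[of \<gamma> k k] \<gamma> by auto
    have "lookup z \<gamma> = ?B (single \<alpha> 1) (single \<beta> 1)"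
      by (simp add: moment_form_def mult_single pairing_single ab)
    also have "\<dots> = (\<Sum>e\<in>F. ?B (single \<alpha> 1) e * ?B (single \<beta> 1) e)"
      using ab by (intro parseval single_in_trunc_space)
    also have "\<dots> = (\<Sum>e\<in>F. (a e)\<^sup>2 * monom_val (u e) \<gamma>)"
      using mono ab by (intro sum.cong) (auto simp: monom_val_add power2_eq_square)
    finally show ?thesis .
  qed
  show thesis
  proof (rule that)
    show "finite F" "F \<subseteq> ?Vs" using F WVs by auto
    show "pairing p z = (\<Sum>e\<in>F. (a e)\<^sup>2 * peval p (u e))" if "p \<in> trunc_space (2 * k)" for p
    proof -
      have "pairing p z = (\<Sum>\<alpha>\<in>keys p. \<Sum>e\<in>F. (a e)\<^sup>2 * (lookup p \<alpha> * monom_val (u e) \<alpha>))"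
        unfolding pairing_def using that mom
        by (intro sum.cong) (auto simp: mem_trunc_space_iff sum_distrib_left mult_ac)
      also have "\<dots> = (\<Sum>e\<in>F. (a e)\<^sup>2 * peval p (u e))"
        by (subst sum.swap) (simp add: peval_def sum_distrib_left)
      finally show ?thesis .
    qed
    show "a e' * peval e (u e') = (if e = e' then 1 else 0)" if "e \<in> F" "e' \<in> F" for e e'
      unfolding poly[OF that(2) WVk[OF FW[OF that(1)]], symmetric]
      by (rule bspec[OF bspec[OF orth that(1)] that(2)])
  qed
qed

text \<open>
  All atoms lie in the semialgebraic set: the polynomial \<open>e\<close> vanishes at every atom except its own, so
  \<open>\<langle>q e\<^sup>2, z\<rangle>\<close> is the value of \<open>q\<close> there, and it is nonnegative by the localizing matrix of \<open>q\<close>.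
  The gap \<open>order_d2 g\<close> between the two orders is what keeps the degree of \<open>q e\<^sup>2\<close> within \<open>2k\<close>.
\<close>

lemma flat_extension_nonneg:
  fixes z :: "('v::finite) tms"
  assumes psd: "moment_psd k z" and flat: "moment_rank k z = moment_rank (k - order_d2 g) z"
    and g: "1 \<le> tuple_deg g" "order_d2 g \<le> k" and loc: "\<And>q. q \<in> set g \<Longrightarrow> loc_psd k q z"
    and p: "p \<in> nonneg_polys (2 * k) (basic_set g)"
  shows "0 \<le> pairing p z"
proof -
  define s where "s = k - order_d2 g"
  have d2: "1 \<le> order_d2 g" using g(1) by (simp add: order_d2_def half_up_def)
  have sk: "s < k" using d2 g(2) by (simp add: s_def)
  have flat': "moment_rank k z = moment_rank s z" using flat by (simp add: s_def)
  obtain F and a :: "'v rpoly \<Rightarrow> real" and u where F: "finite F" "F \<subseteq> trunc_space s"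
    and rep: "\<And>p. p \<in> trunc_space (2 * k) \<Longrightarrow> pairing p z = (\<Sum>e\<in>F. (a e)\<^sup>2 * peval p (u e))"
    and dual: "\<And>e e'. e \<in> F \<Longrightarrow> e' \<in> F \<Longrightarrow> a e' * peval e (u e') = (if e = e' then 1 else 0)"
    by (rule flat_extension[OF psd flat' sk]) blast
  have "u e \<in> basic_set g" if e: "e \<in> F" for e
    unfolding basic_set_def
  proof (intro CollectI ballI)
    fix q assume q: "q \<in> set g"
    have "pdeg q \<le> tuple_deg g" using q by (simp add: tuple_deg_def)
    hence hq: "half_up (pdeg q) \<le> order_d2 g" by (simp add: order_d2_def half_up_def div_le_mono)
    have eV: "e \<in> trunc_space s" using F(2) e by blast
    have "q * e * e \<in> trunc_space (pdeg q + s + s)"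
      by (intro trunc_space_mult trunc_space_pdeg eV)
    moreover have "pdeg q + s + s \<le> 2 * k"
      using hq g(2) by (simp add: half_up_def s_def)
    ultimately have V: "q * e * e \<in> trunc_space (2 * k)" using trunc_space_mono by blast
    have "0 \<le> pairing (q * e * e) z"
      using hq g(2) by (intro loc_psd_square_nonneg[OF loc[OF q] eV]) (simp add: s_def)
    also have "\<dots> = (\<Sum>e'\<in>F. (a e' * peval e (u e'))\<^sup>2 * peval q (u e'))"
      unfolding rep[OF V] by (simp add: peval_mult power2_eq_square mult_ac)
    also have "\<dots> = (\<Sum>e'\<in>F. if e = e' then peval q (u e) else 0)"
      using dual[OF e] by (intro sum.cong) auto
    also have "\<dots> = peval q (u e)" using e F(1) by simp
    finally show "0 \<le> peval q (u e)" .
  qed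
  thus ?thesis
    using p by (auto simp: nonneg_polys_def rep intro!: sum_nonneg)
qed


section \<open>Quadratic modules and conic hulls\<close>

lemma sos_nonneg: "\<sigma> \<in> sos e \<Longrightarrow> 0 \<le> peval \<sigma> u"
  by (auto simp: sos_def peval_sum_list peval_mult power2_eq_square intro!: sum_list_nonneg)

lemma QM_nonneg:
  assumes "q \<in> QM ps e" "u \<in> basic_set ps"
  shows "0 \<le> peval q u"
proof -
  obtain \<sigma>0 \<sigma> where q: "q = \<sigma>0 + (\<Sum>i<length ps. ps ! i * \<sigma> i)" "\<sigma>0 \<in> sos e"
    "\<And>i. i < length ps \<Longrightarrow> \<sigma> i \<in> sos (e - pdeg (ps ! i))"
    using assms(1) by (auto simp: QM_def)
  show ?thesis
    using assms(2) sos_nonneg[OF q(2)] sos_nonneg[OF q(3)]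
    by (auto simp: q(1) peval_add peval_sum peval_mult basic_set_def
        intro!: add_nonneg_nonneg sum_nonneg mult_nonneg_nonneg)
qed

lemma pairing_convex_cone_hull_nonneg:
  assumes "\<And>y. y \<in> T \<Longrightarrow> 0 \<le> pairing q y" and y: "y \<in> convex_cone hull T"
  shows "0 \<le> pairing q y"
proof -
  have "convex_cone {y. 0 \<le> pairing q y}"
    by (simp add: convex_cone_iff pairing_add_right pairing_scaleR_right) (simp add: pairing_def)
  hence "convex_cone hull T \<subseteq> {y. 0 \<le> pairing q y}"
    using assms(1) by (intro hull_minimal) auto
  thus ?thesis using y by blast
qed


section \<open>Moment matrices of rank one\<close>

lemma proportional_if_dim_1:
  fixes S :: "'a::real_vector set"
  assumes "dim S = 1" "v \<in> S" "v \<noteq> 0" "x \<in> S"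
  shows "\<exists>c. x = c *\<^sub>R v"
proof -
  obtain B where B: "B \<subseteq> S" "independent B" "S \<subseteq> span B" "card B = dim S"
    by (rule real_vector.basis_exists)
  then obtain b where b: "B = {b}" using assms(1) card_1_singletonE by metis
  obtain cv cx where c: "v = cv *\<^sub>R b" "x = cx *\<^sub>R b"
    using B(3) assms(2,4) unfolding b span_singleton by blast
  hence "x = (cx / cv) *\<^sub>R v" using assms(3) by auto
  thus ?thesis by blast
qed

text \<open>
  In rank one every column is a multiple of column \<open>0\<close>; comparing entries in row \<open>0\<close>, where column
  \<open>0\<close> has entry \<open>1\<close>, gives \<open>w\<^sub>\<alpha>\<^sub>+\<^sub>\<beta> = w\<^sub>\<alpha> w\<^sub>\<beta>\<close>. So \<open>w\<close> is multiplicative and is determined by its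
  entries of degree one.
\<close>

lemma rank_one_moments:
  assumes rank: "moment_rank t w = 1" and w0: "lookup w 0 = 1" and \<gamma>: "mdeg \<gamma> \<le> 2 * t"
  shows "lookup w \<gamma> = monom_val (proj1 w) \<gamma>"
proof -
  let ?S = "moment_col t w ` (\<lambda>\<alpha>. single \<alpha> 1) ` mons t"
  have col: "lookup (moment_col t w (single \<beta> 1)) \<alpha> = lookup w (\<beta> + \<alpha>)" if "mdeg \<alpha> \<le> t" for \<alpha> \<beta>
    using that by (simp add: moment_col_def lookup_tvec mons_def moment_form_def mult_single pairing_single)
  have dim: "dim ?S = 1" using rank by (simp add: moment_rank_eq_dim)
  have S: "moment_col t w (single \<beta> 1) \<in> ?S" if "mdeg \<beta> \<le> t" for \<beta>
    using that by (auto simp: mons_def)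
  have ne: "moment_col t w (single 0 1) \<noteq> 0"
    using col[of 0 0] w0 by auto
  have mult: "lookup w (\<beta> + \<alpha>) = lookup w \<beta> * lookup w \<alpha>" if ab: "mdeg \<alpha> \<le> t" "mdeg \<beta> \<le> t" for \<alpha> \<beta>
  proof -
    have "moment_col t w (single 0 1) \<in> ?S" by (rule S) simp
    then obtain c where c: "moment_col t w (single \<beta> 1) = c *\<^sub>R moment_col t w (single 0 1)"
      using proportional_if_dim_1[OF dim _ ne S[OF ab(2)]] by blast
    have eq: "lookup w (\<beta> + \<delta>) = c * lookup w \<delta>" if "mdeg \<delta> \<le> t" for \<delta>
      using col[OF that, of \<beta>] col[OF that, of 0] by (simp add: c lookup_scaleR)
    have "c = lookup w \<beta>" using eq[of 0] w0 by simp
    thus ?thesis using eq[OF ab(1)] by simp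
  qed
  have low: "lookup w \<alpha> = monom_val (proj1 w) \<alpha>" if "mdeg \<alpha> \<le> t" for \<alpha>
    using that
  proof (induction "mdeg \<alpha>" arbitrary: \<alpha>)
    case 0
    thus ?case using mdeg_eq_0_iff[of \<alpha>] w0 by simp
  next
    case (Suc n)
    obtain i \<beta> where \<alpha>: "\<alpha> = single i 1 + \<beta>" "mdeg \<beta> = n"
      using mdeg_Suc_decomp[OF Suc(2)[symmetric]] by blast
    have "lookup w \<alpha> = lookup w (single i 1) * lookup w \<beta>"
      unfolding \<alpha>(1) by (rule mult) (use Suc \<alpha> in \<open>simp_all add: mdeg_single\<close>)
    also have "lookup w \<beta> = monom_val (proj1 w) \<beta>" using Suc \<alpha> by auto
    also have "lookup w (single i 1) = monom_val (proj1 w) (single i 1)"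
      unfolding monom_val_single by (simp add: proj1_def)
    finally show ?case by (simp add: \<alpha>(1) monom_val_add)
  qed
  obtain \<alpha> \<beta> where ab: "\<gamma> = \<alpha> + \<beta>" "mdeg \<alpha> \<le> t" "mdeg \<beta> \<le> t"
    using mdeg_split[of \<gamma> t t] \<gamma> by auto
  thus ?thesis using mult low by (simp add: monom_val_add)
qed

lemma pairing_rank_one:
  assumes "moment_rank t w = 1" "lookup w 0 = 1" "p \<in> trunc_space (2 * t)"
  shows "pairing p w = peval p (proj1 w)"
  unfolding pairing_def peval_def
  using assms(3) by (intro sum.cong) (auto simp: mem_trunc_space_iff rank_one_moments[OF assms(1,2)])


section \<open>The robust constraint and the relaxations\<close>

text \<open>
  The polynomial \<open>h(x, \<cdot>)\<close> in \<open>\<xi>\<close>.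
\<close>

definition h_at :: "('n::finite, 'p::finite) bipoly \<Rightarrow> real ^ 'n \<Rightarrow> 'p rpoly"
  where "h_at h x = tvec (pdeg h) (\<lambda>\<beta>. peval (lookup h \<beta>) x)"

lemma h_at_in_trunc_space: "h_at h x \<in> trunc_space (pdeg h)"
  by (auto simp: h_at_def trunc_space_def in_keys_iff lookup_tvec split: if_splits)

lemma integral_bieval:
  assumes "\<mu> \<in> ambiguity_set (pdeg h) g Y"
  shows "(\<integral>\<xi>. bieval h x \<xi> \<partial>\<mu>) = pairing (h_at h x) (mom_vec (pdeg h) \<mu>)"
proof -
  have "keys h \<subseteq> mons (pdeg h)" by (auto simp: mons_def pdeg_def)
  hence "bieval h x \<xi> = (\<Sum>\<beta>\<in>mons (pdeg h). peval (lookup h \<beta>) x * monom_val \<xi> \<beta>)" for \<xi>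
    unfolding bieval_def by (intro sum.mono_neutral_left finite_mons) (auto simp: in_keys_iff)
  moreover have "integrable \<mu> (\<lambda>\<xi>. peval (lookup h \<beta>) x * monom_val \<xi> \<beta>)" if "\<beta> \<in> mons (pdeg h)" for \<beta>
    using assms that by (simp add: ambiguity_set_def)
  ultimately show ?thesis
    by (simp add: h_at_def pairing_tvec mom_vec_def lookup_tvec cong: sum.cong)
qed

text \<open>
  The expectation of \<open>h(x, \<xi>)\<close> depends on the measure only through its moment vector, and linear
  inequalities pass from a set to its conic hull.
\<close>

lemma DRO_feasible_iff:
  "DRO_feasible h c g Y x \<longleftrightarrow>
     x \<in> basic_set c \<and> h_at h x \<in> dual_cone (pdeg h) (moment_cone (pdeg h) g Y)"
proof -
  let ?M = "ambiguity_set (pdeg h) g Y"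
  have "(INF \<mu>\<in>?M. ereal (\<integral>\<xi>. bieval h x \<xi> \<partial>\<mu>)) \<ge> 0 \<longleftrightarrow>
      (\<forall>\<mu>\<in>?M. 0 \<le> pairing (h_at h x) (mom_vec (pdeg h) \<mu>))"
    by (simp add: le_INF_iff integral_bieval zero_ereal_def cong: ball_cong)
  also have "\<dots> \<longleftrightarrow> h_at h x \<in> dual_cone (pdeg h) (moment_cone (pdeg h) g Y)"
    unfolding dual_cone_def moment_cone_def using h_at_in_trunc_space[of h x]
    by (auto intro: hull_inc pairing_convex_cone_hull_nonneg[rotated])
  finally show ?thesis by (simp add: DRO_feasible_def)
qed

lemma order_t_bounds:
  shows "deg_x h \<le> 2 * order_t f h c" and "pdeg f \<le> 2 * order_t f h c"
    and "p \<in> set c \<Longrightarrow> half_up (pdeg p) \<le> order_t f h c"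
proof -
  have 1: "half_up (deg_x h) \<le> order_t f h c" "half_up (pdeg f) \<le> order_t f h c"
    "half_up (tuple_deg c) \<le> order_t f h c"
    by (simp_all add: order_t_def)
  show "deg_x h \<le> 2 * order_t f h c" "pdeg f \<le> 2 * order_t f h c"
    using 1 by (simp_all add: half_up_def)
  assume "p \<in> set c"
  hence "pdeg p \<le> tuple_deg c" by (simp add: tuple_deg_def)
  thus "half_up (pdeg p) \<le> order_t f h c" using 1(3) by (simp add: half_up_def)
qed

lemma peval_H_app_transpose:
  assumes "deg_x h \<le> 2 * t"
  shows "peval (H_app_transpose t h y) x = pairing (h_at h x) y"
proof -
  have "peval (H_app_transpose t h y) x =
      (\<Sum>\<alpha>\<in>mons (2 * t). \<Sum>\<beta>\<in>mons (pdeg h). H_mat h \<beta> \<alpha> * monom_val x \<alpha> * lookup y \<beta>)"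
    by (simp add: H_app_transpose_def peval_tvec sum_distrib_left sum_distrib_right mult_ac)
  also have "\<dots> = (\<Sum>\<beta>\<in>mons (pdeg h). peval (lookup h \<beta>) x * lookup y \<beta>)"
    by (subst sum.swap) (simp add: bieval_H_mat[OF assms] sum_distrib_right cong: sum.cong)
  finally show ?thesis by (simp add: h_at_def pairing_tvec)
qed

lemma H_app_moments:
  assumes "deg_x h \<le> 2 * t" and "\<And>\<alpha>. mdeg \<alpha> \<le> 2 * t \<Longrightarrow> lookup w \<alpha> = monom_val x \<alpha>"
  shows "H_app t h w = h_at h x"
proof (rule poly_mapping_eqI)
  fix \<beta>
  have "(\<Sum>\<alpha>\<in>mons (2 * t). H_mat h \<beta> \<alpha> * lookup w \<alpha>) =
      (\<Sum>\<alpha>\<in>mons (2 * t). H_mat h \<beta> \<alpha> * monom_val x \<alpha>)"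
    by (intro sum.cong) (auto simp: mons_def assms(2))
  thus "lookup (H_app t h w) \<beta> = lookup (h_at h x) \<beta>"
    by (simp add: H_app_def h_at_def lookup_tvec bieval_H_mat[OF assms(1)])
qed


section \<open>Termination of the algorithm and global optimality\<close>

text \<open>
  What Steps 1 to 3 have established when the algorithm terminates, by an invariant on its states. The
  vector \<open>zh\<close> belongs to the same \<open>y\<close> as the dual optimizer of the final order.
\<close>

lemma algorithm_output:
  assumes "alg_outputs f h c g Y R k w x"
  obtains \<gamma> y z k1 zh
  where "is_arg_min (pairing f) (P_feasible f h c g Y k) w"
    and "is_arg_max fst (D_feasible f h c g Y k) (\<gamma>, y, z)"
    and "MP_feasible (pdeg h) g k1 y zh" and "rank_condition h g k1 zh" and "x = proj1 w"
proof -
  let ?opt = "\<lambda>k w y. is_arg_min (pairing f) (P_feasible f h c g Y k) w \<and>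
      (\<exists>\<gamma> z. is_arg_max fst (D_feasible f h c g Y k) (\<gamma>, y, z))"
  let ?inv = "\<lambda>s. case s of Step1 k k1 \<Rightarrow> True | Step2 k k1 w y \<Rightarrow> ?opt k w y
      | Step3 k k1 w y zh \<Rightarrow> ?opt k w y \<and> MP_feasible (pdeg h) g k1 y zh
      | Output k w x \<Rightarrow> (\<exists>y k1 zh. ?opt k w y \<and> MP_feasible (pdeg h) g k1 y zh \<and>
          rank_condition h g k1 zh \<and> x = proj1 w)"
  have step: "?inv s \<Longrightarrow> ?inv s'" if "alg_step f h c g Y R s s'" for s s'
    using that by cases (auto simp: is_arg_min_def)
  have "?inv s" if "(alg_step f h c g Y R)\<^sup>*\<^sup>* (Step1 k0 k1) s" for s k0 k1
    using that by (induction rule: rtranclp_induct) (simp, blast intro: step)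
  from this[OF assms[unfolded alg_outputs_def]] show thesis using that by auto
qed

lemma P_value_attained:
  assumes "is_arg_min (pairing f) (P_feasible f h c g Y k) w"
  shows "P_value f h c g Y k = ereal (pairing f w)"
  unfolding P_value_def using assms
  by (intro antisym INF_lower2[of w] INF_greatest) (auto simp: is_arg_min_linorder)

lemma D_value_attained:
  assumes "is_arg_max fst (D_feasible f h c g Y k) (\<gamma>, y, z)"
  shows "D_value f h c g Y k = ereal \<gamma>"
  unfolding D_value_def using assms
  by (intro antisym SUP_upper2[of "(\<gamma>, y, z)"] SUP_least)
     (auto simp: is_arg_max_linorder simp del: split_paired_All)

theorem theorem4p4:
  fixes f :: "('n::finite) rpoly" and h :: "('n, 'p::finite) bipoly"
    and c :: "'n rpoly list" and g :: "'p rpoly list" and Y :: "'p tms set"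
    and R :: "'p rpoly" and k :: nat and w :: "'n tms" and x :: "real ^ 'n"
  assumes Y: "conic_set (pdeg h) Y"
    and g_nonconst: "tuple_deg g \<ge> 1"
    and dual_K: "dual_cone (pdeg h) (moment_cone (pdeg h) g Y)
                   = nonneg_polys (pdeg h) (basic_set g) + dual_cone (pdeg h) Y"
    and R: "R \<in> sos (2 * init_k1 h)"
    and alg_out: "alg_outputs f h c g Y R k w x"
    and no_gap: "P_value f h c g Y k = D_value f h c g Y k"
    and rank1: "moment_rank (order_t f h c) w = 1"
  shows "DRO_optimizer f h c g Y x"
proof -
  define t where "t = order_t f h c"
  define d where "d = pdeg h"
  obtain \<gamma> y z k1 zh
    where w: "is_arg_min (pairing f) (P_feasible f h c g Y k) w"
      and D: "is_arg_max fst (D_feasible f h c g Y k) (\<gamma>, y, z)"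
      and zh: "MP_feasible d g k1 y zh" and rank: "rank_condition h g k1 zh" and x: "x = proj1 w"
    using algorithm_output[OF alg_out] unfolding d_def by metis
  have dx: "deg_x h \<le> 2 * t" by (simp add: t_def order_t_bounds)
  have "P_feasible f h c g Y k w" using w by (simp add: is_arg_min_def)
  hence wH: "H_app t h w \<in> (QM g (2 * k) \<inter> trunc_space d) + dual_cone d Y"
    and wc: "\<And>p. p \<in> set c \<Longrightarrow> loc_psd t p w" and w0: "lookup w 0 = 1"
    by (auto simp: P_feasible_def Let_def t_def d_def)
  have "D_feasible f h c g Y k (\<gamma>, y, z)" using D by (simp add: is_arg_max_def)
  hence Dsos: "f - H_app_transpose t h y - single 0 \<gamma> \<in> QM c (2 * t)" and yY: "y \<in> convex_cone hull Y"
    by (auto simp: D_feasible_def Let_def t_def d_def)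
  note rank1' = rank1[folded t_def]
  have f\<gamma>: "pairing f w = \<gamma>"
    using no_gap P_value_attained[OF w] D_value_attained[OF D] by simp
  have "f \<in> trunc_space (2 * t)"
    using trunc_space_pdeg trunc_space_mono[OF order_t_bounds(2)] unfolding t_def by blast
  hence fx: "pairing f w = peval f x"
    unfolding x by (rule pairing_rank_one[OF rank1' w0])
  have "H_app t h w = h_at h x"
    unfolding x by (rule H_app_moments[OF dx rank_one_moments[OF rank1' w0]])
  hence "h_at h x \<in> nonneg_polys d (basic_set g) + dual_cone d Y"
    using wH by (auto simp: set_plus_def nonneg_polys_def intro: QM_nonneg)
  moreover have "x \<in> basic_set c"
    unfolding basic_set_def
  proof (intro CollectI ballI)
    fix p assume p: "p \<in> set c"
    have hp: "half_up (pdeg p) \<le> t" using order_t_bounds(3)[OF p] by (simp add: t_def)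
    have "0 \<le> pairing (p * 1 * 1) w"
      using hp by (intro loc_psd_square_nonneg[OF wc[OF p], of 1 0])
        (auto simp: mem_trunc_space_iff)
    moreover have "p \<in> trunc_space (2 * t)"
    proof -
      have "pdeg p \<le> 2 * t" using hp by (simp add: half_up_def)
      thus ?thesis using trunc_space_pdeg trunc_space_mono by blast
    qed
    ultimately show "0 \<le> peval p x"
      by (simp add: x pairing_rank_one[OF rank1' w0])
  qed
  ultimately have feas: "DRO_feasible h c g Y x"
    using dual_K by (simp add: DRO_feasible_iff d_def)
  \<comment> \<open>the rank test at \<open>d1\<close>, whose order \<open>2 d1 \<ge> d\<close> covers all entries of \<open>y\<close>\<close>
  have pair: "0 \<le> pairing p y" if p: "p \<in> nonneg_polys d (basic_set g)" for p
  proof -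
    obtain d1 where d1: "order_d0 h g \<le> d1" "d1 \<le> k1"
      and flat: "moment_rank d1 zh = moment_rank (d1 - order_d2 g) zh"
      using rank by (auto simp: rank_condition_def)
    have dd: "d \<le> 2 * d1" "order_d2 g \<le> d1"
      using d1(1) by (auto simp: order_d0_def order_d2_def half_up_def d_def)
    have "0 \<le> pairing p zh"
    proof (rule flat_extension_nonneg[OF _ flat g_nonconst dd(2)])
      show "moment_psd d1 zh" "\<And>q. q \<in> set g \<Longrightarrow> loc_psd d1 q zh"
        using zh d1(2) by (auto simp: MP_feasible_def moment_psd_iff_loc_psd intro: loc_psd_mono)
      show "p \<in> nonneg_polys (2 * d1) (basic_set g)"
        using p trunc_space_mono[OF dd(1)] by (auto simp: nonneg_polys_def)
    qed
    also have "pairing p zh = pairing p y"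
      using zh p pairing_trunc[of p d zh] by (auto simp: MP_feasible_def nonneg_polys_def)
    finally show ?thesis .
  qed
  have "peval f x \<le> peval f x'" if x': "DRO_feasible h c g Y x'" for x'
  proof -
    have "x' \<in> basic_set c" and "h_at h x' \<in> nonneg_polys d (basic_set g) + dual_cone d Y"
      using x' dual_K by (simp_all add: DRO_feasible_iff d_def)
    then obtain p q where pq: "h_at h x' = p + q" "p \<in> nonneg_polys d (basic_set g)" "q \<in> dual_cone d Y"
      by (auto simp: set_plus_def)
    have "0 \<le> pairing q y"
      using pq(3) by (intro pairing_convex_cone_hull_nonneg[OF _ yY]) (simp add: dual_cone_def)
    hence "0 \<le> pairing (h_at h x') y"
      using pair[OF pq(2)] by (simp add: pq(1) pairing_add)
    moreover have "0 \<le> peval f x' - pairing (h_at h x') y - \<gamma>"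
      using QM_nonneg[OF Dsos \<open>x' \<in> basic_set c\<close>]
      by (simp add: peval_diff peval_H_app_transpose[OF dx] peval_single)
    ultimately show ?thesis using f\<gamma> fx by linarith
  qed
  thus ?thesis
    using feas by (auto simp: DRO_optimizer_def is_arg_min_linorder)
qed

end
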